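(* Let $G=(X,E)$ be a finite connected graph, let $x\neq y$ be two vertices with graph distance $d=d(x,y)$, and consider the simple double-well potential $W=\chi_{\{x,y\}}$ (i.e. $W(x)=W(y)=1$ and $W(v)=0$ for all other $v$), with Hamiltonian $H=\Delta-QW$. Then, for tunneling from $x$ to $y$ (and likewise from $y$ to $x$): (1) if $co(x,y)\ge d$, there is perfect asymptotic tunneling ($TC(x,y)=1$); (2) if $co(x,y)=d-1$, there is partial tunneling ($0<TC(x,y)<1$); (3) if $co(x,y)<d-1$, there is no tunneling ($TC(x,y)=0$). Moreover, whenever there is tunneling (cases (1) and (2)), the tunneling time is $\Theta(Q^{d-1})$.
   Context: $G=(X,E)$ is a finite connected graph and $d_v$ denotes the degree of $v\in X$. The symmetrized Laplacian $\Delta$ is the $X\times X$ matrix with $\Delta(v,v)=1$, $\Delta(v,w)=-1/\sqrt{d_vd_w}$ if $vw\in E$, and $0$ otherwise. For $W:X\to\mathbb{R}$ (identified with the diagonal matrix) and a real parameter $Q$, the Hamiltonian is $H=\Delta-QW$. For a starting vertex $u$, the state at time $t$ is $\varphi_t=e^{itH}\chi_u$ (the solution of $-i\frac{d}{dt}\varphi_t=H\varphi_t$, $\varphi_0=\chi_u$, where $\chi_u$ is the indicator vector of $u$); it depends on $Q$. The tunneling coefficient from $u$ to $v$ is $TC(u,v)=\liminf_{Q\to\infty}\sup_{t\in[0,\infty)}|\varphi_t(v)|^2$. Perfect tunneling means $TC(u,v)=1$, partial tunneling $0<TC(u,v)<1$, no tunneling $TC(u,v)=0$. Tunneling from $u$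 to $v$ happens within time $f(Q)$ if $TC(u,v)=\liminf_{Q\to\infty}\sup_{t\in[0,f(Q)]}|\varphi_t(v)|^2$; Bachmann–Landau notation is used for tunneling times (e.g. "tunneling time $\Theta(g(Q))$": tunneling happens within some time $f(Q)=O(g(Q))$, and not within any time $f(Q)=o(g(Q))$). $PR(v,k)$ denotes the probability that the simple random walk started at $v$ is back at $v$ at time $k$. Two vertices $x,y$ are $m$-cospectral if $PR(x,k)=PR(y,k)$ for all $0\le k\le m$; the cospectrality $co(x,y)$ is the maximal such $m$ (possibly $\infty$). *)

theory Defs
  imports Complex_Main "HOL-Library.Extended_Nat" "HOL-Library.Extended_Real"
    "HOL-Library.Liminf_Limsup" "HOL-Library.Landau_Symbols"
begin

text \<open>A finite graph: vertex set = the finite type 'a, edge relation E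
  (symmetric, irreflexive).\<close>

definition deg :: "('a::finite \<Rightarrow> 'a \<Rightarrow> bool) \<Rightarrow> 'a \<Rightarrow> nat" where
  "deg E v = card {w. E v w}"

definition is_walk :: "('a \<Rightarrow> 'a \<Rightarrow> bool) \<Rightarrow> (nat \<Rightarrow> 'a) \<Rightarrow> nat \<Rightarrow> 'a \<Rightarrow> 'a \<Rightarrow> bool" where
  "is_walk E p n u v \<longleftrightarrow> p 0 = u \<and> p n = v \<and> (\<forall>i<n. E (p i) (p (Suc i)))"

definition connected_graph :: "('a \<Rightarrow> 'a \<Rightarrow> bool) \<Rightarrow> bool" where
  "connected_graph E \<longleftrightarrow> (\<forall>u v. \<exists>p n. is_walk E p n u v)"

definition gdist :: "('a \<Rightarrow> 'a \<Rightarrow> bool) \<Rightarrow> 'a \<Rightarrow> 'a \<Rightarrow> nat" where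
  "gdist E u v = (LEAST n. \<exists>p. is_walk E p n u v)"

definition mat_mult :: "('a::finite \<Rightarrow> 'a \<Rightarrow> 'b::comm_semiring_0) \<Rightarrow> ('a \<Rightarrow> 'a \<Rightarrow> 'b) \<Rightarrow> 'a \<Rightarrow> 'a \<Rightarrow> 'b" where
  "mat_mult A B i j = (\<Sum>k\<in>UNIV. A i k * B k j)"

fun mat_pow :: "('a::finite \<Rightarrow> 'a \<Rightarrow> 'b::comm_semiring_1) \<Rightarrow> nat \<Rightarrow> 'a \<Rightarrow> 'a \<Rightarrow> 'b" where
  "mat_pow A 0 = (\<lambda>i j. if i = j then 1 else 0)"
| "mat_pow A (Suc n) = mat_mult A (mat_pow A n)"

definition laplacian :: "('a::finite \<Rightarrow> 'a \<Rightarrow> bool) \<Rightarrow> 'a \<Rightarrow> 'a \<Rightarrow> real" where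
  "laplacian E v w = (if v = w then 1 else if E v w then - 1 / sqrt (real (deg E v * deg E w)) else 0)"

definition hamiltonian :: "('a::finite \<Rightarrow> 'a \<Rightarrow> bool) \<Rightarrow> ('a \<Rightarrow> real) \<Rightarrow> real \<Rightarrow> 'a \<Rightarrow> 'a \<Rightarrow> real" where
  "hamiltonian E W Q v w = laplacian E v w - (if v = w then Q * W v else 0)"

text \<open>State at time t: phi_t = exp(i t H) chi_u, evaluated at v,
  with the matrix exponential given by its power series.\<close>
definition state :: "('a::finite \<Rightarrow> 'a \<Rightarrow> bool) \<Rightarrow> ('a \<Rightarrow> real) \<Rightarrow> real \<Rightarrow> 'a \<Rightarrow> real \<Rightarrow> 'a \<Rightarrow> complex" where
  "state E W Q u t v = (\<Sum>k. (\<i> * complex_of_real t) ^ k / of_nat (fact k)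
        * mat_pow (\<lambda>a b. complex_of_real (hamiltonian E W Q a b)) k v u)"

definition TC :: "('a::finite \<Rightarrow> 'a \<Rightarrow> bool) \<Rightarrow> ('a \<Rightarrow> real) \<Rightarrow> 'a \<Rightarrow> 'a \<Rightarrow> ereal" where
  "TC E W u v = Liminf at_top (\<lambda>Q. SUP t\<in>{0..}. ereal ((cmod (state E W Q u t v))\<^sup>2))"

definition TC_within :: "('a::finite \<Rightarrow> 'a \<Rightarrow> bool) \<Rightarrow> ('a \<Rightarrow> real) \<Rightarrow> (real \<Rightarrow> real) \<Rightarrow> 'a \<Rightarrow> 'a \<Rightarrow> ereal" where
  "TC_within E W f u v = Liminf at_top (\<lambda>Q. SUP t\<in>{0..f Q}. ereal ((cmod (state E W Q u t v))\<^sup>2))"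

definition tunnels_within :: "('a::finite \<Rightarrow> 'a \<Rightarrow> bool) \<Rightarrow> ('a \<Rightarrow> real) \<Rightarrow> (real \<Rightarrow> real) \<Rightarrow> 'a \<Rightarrow> 'a \<Rightarrow> bool" where
  "tunnels_within E W f u v \<longleftrightarrow> TC E W u v = TC_within E W f u v"

definition tunneling_time_Theta :: "('a::finite \<Rightarrow> 'a \<Rightarrow> bool) \<Rightarrow> ('a \<Rightarrow> real) \<Rightarrow> (real \<Rightarrow> real) \<Rightarrow> 'a \<Rightarrow> 'a \<Rightarrow> bool" where
  "tunneling_time_Theta E W g u v \<longleftrightarrow>
     (\<exists>f. f \<in> O[at_top](g) \<and> tunnels_within E W f u v) \<and>
     (\<forall>f. f \<in> o[at_top](g) \<longrightarrow> \<not> tunnels_within E W f u v)"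

definition rw_matrix :: "('a::finite \<Rightarrow> 'a \<Rightarrow> bool) \<Rightarrow> 'a \<Rightarrow> 'a \<Rightarrow> real" where
  "rw_matrix E v w = (if E v w then 1 / real (deg E v) else 0)"

definition PR :: "('a::finite \<Rightarrow> 'a \<Rightarrow> bool) \<Rightarrow> 'a \<Rightarrow> nat \<Rightarrow> real" where
  "PR E v k = mat_pow (rw_matrix E) k v v"

definition m_cospectral :: "('a::finite \<Rightarrow> 'a \<Rightarrow> bool) \<Rightarrow> nat \<Rightarrow> 'a \<Rightarrow> 'a \<Rightarrow> bool" where
  "m_cospectral E m x y \<longleftrightarrow> (\<forall>k\<le>m. PR E x k = PR E y k)"

definition cospectrality :: "('a::finite \<Rightarrow> 'a \<Rightarrow> bool) \<Rightarrow> 'a \<Rightarrow> 'a \<Rightarrow> enat" where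
  "cospectrality E x y = (if \<forall>m. m_cospectral E m x y then \<infinity>
     else enat (GREATEST m. m_cospectral E m x y))"

end

theory Submission
  imports Defs "HOL-Analysis.Analysis"
begin

text \<open>
  Up to a phase and the sign of time, the evolution is generated by \<open>K = A + Q W\<close>, where \<open>A\<close> is the
  normalized adjacency matrix. For large \<open>Q\<close> exactly two eigenvalues of \<open>K\<close> exceed \<open>Q / 2\<close>; their
  eigenvectors live almost entirely on the wells, with entries \<open>p\<close> at \<open>x\<close> and \<open>q\<close> at \<open>y\<close>, and all
  other eigenvectors almost vanish there. Hence \<open>|\<phi>\<^sub>t(y)|\<close> is \<open>|p q| |e\<^bsup>i t g\<^esup> - 1|\<close> up to \<open>O(1/Q)\<close>, with
  \<open>g\<close> the gap between the two eigenvalues.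

  Eliminating the vertices outside the wells gives, for each of the two eigenvalues \<open>\<mu>\<close>,
  \<open>p q (\<Sum>k<d. \<alpha>\<^sub>k \<mu>\<^bsup>d-1-k\<^esup>) + \<beta> (q\<^sup>2 - p\<^sup>2) = O(1/Q)\<close>, where \<open>\<beta> = A\<^sup>d(y, x) > 0\<close> and \<open>\<alpha>\<^sub>k\<close> is the
  difference of the weights of the walks of length \<open>k + 1\<close> that return to \<open>x\<close>, respectively \<open>y\<close>, for
  the first time. A renewal argument shows that \<open>m\<close>-cospectrality with \<open>m \<le> d\<close> means \<open>\<alpha>\<^sub>k = 0\<close>
  for \<open>k < m\<close>. So \<open>4 (p q)\<^sup>2\<close>, and with it the tunneling coefficient, tends to
  \<open>4 \<beta>\<^sup>2 / (\<alpha>\<^sub>d\<^sub>-\<^sub>1\<^sup>2 + 4 \<beta>\<^sup>2)\<close> if \<open>co(x, y) \<ge> d - 1\<close> and to \<open>0\<close> otherwise. In the former case the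
  same elimination, applied to the pair of eigenvectors, gives a gap of order \<open>Q\<^bsup>-(d-1)\<^esup>\<close>.
\<close>

section \<open>Spectral decomposition of symmetric matrices\<close>

text \<open>Variational argument: let \<open>v\<close> maximize the quadratic form on the compact
  unit sphere of \<open>S\<close>. The first variation at \<open>v\<close> in every direction of
  \<open>S\<close> vanishes, so \<open>l *\<^sub>R v - f v\<close> is orthogonal to
  \<open>S\<close>; as it also lies in \<open>S\<close>, it is zero.\<close>

lemma selfadjoint_eigenvector:
  fixes f :: "'a::euclidean_space \<Rightarrow> 'a"
  assumes lin: "linear f" and sa: "\<And>v w. f v \<bullet> w = v \<bullet> f w"
    and S: "subspace S" "f ` S \<subseteq> S" "S \<noteq> {0}"
  shows "\<exists>v\<in>S. norm v = 1 \<and> (\<exists>l. f v = l *\<^sub>R v)"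
proof -
  obtain s where s: "s \<in> S" "s \<noteq> 0"
    using S subspace_0 by blast
  have cpt: "compact (S \<inter> sphere 0 1)"
    by (simp add: closed_Int_compact closed_subspace S)
  have ne: "S \<inter> sphere 0 1 \<noteq> {}"
  proof -
    have "s /\<^sub>R norm s \<in> S \<inter> sphere 0 1"
      using s S by (simp add: subspace_scale)
    then show ?thesis by blast
  qed
  have cont: "continuous_on (S \<inter> sphere 0 1) (\<lambda>v. v \<bullet> f v)"
    by (intro continuous_intros linear_continuous_on) (use lin linear_conv_bounded_linear in blast)
  obtain v where v: "v \<in> S" "norm v = 1"
    and vmax: "\<And>w. w \<in> S \<Longrightarrow> norm w = 1 \<Longrightarrow> w \<bullet> f w \<le> v \<bullet> f v"
    using continuous_attains_sup[OF cpt ne cont] by auto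
  define l where "l = v \<bullet> f v"
  have ge: "w \<bullet> f w \<le> l * (w \<bullet> w)" if "w \<in> S" for w
  proof (cases "w = 0")
    case False
    have "(w /\<^sub>R norm w) \<bullet> f (w /\<^sub>R norm w) \<le> l"
      unfolding l_def by (rule vmax) (use that S False in \<open>auto simp: subspace_scale\<close>)
    then have "(w \<bullet> f w) / (norm w)\<^sup>2 \<le> l"
      by (simp add: linear_cmul[OF lin] power2_eq_square divide_inverse mult_ac)
    then show ?thesis using False
      by (simp add: divide_le_eq power2_norm_eq_inner)
  qed (simp add: linear_0[OF lin])
  have vv: "v \<bullet> v = 1" using v(2) by (simp add: norm_eq_1)
  have orth: "(l *\<^sub>R v - f v) \<bullet> w = 0" if w: "w \<in> S" for w
  proof (rule ccontr)
    assume nz: "(l *\<^sub>R v - f v) \<bullet> w \<noteq> 0"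
    define c where "c = (l *\<^sub>R v - f v) \<bullet> w"
    define g where "g = l * (w \<bullet> w) - w \<bullet> f w"
    have key: "0 \<le> t\<^sup>2 * g + 2 * t * c" for t
    proof -
      have "v + t *\<^sub>R w \<in> S" using v w S by (simp add: subspace_add subspace_scale)
      from ge[OF this] have "0 \<le> l * ((v + t *\<^sub>R w) \<bullet> (v + t *\<^sub>R w)) - (v + t *\<^sub>R w) \<bullet> f (v + t *\<^sub>R w)"
        by simp
      also have "\<dots> = t\<^sup>2 * g + 2 * t * c"
        using sa[of v w] vv
        by (simp add: linear_add[OF lin] linear_cmul[OF lin] inner_add inner_diff_left
            inner_add_right g_def c_def algebra_simps power2_eq_square l_def inner_commute)
      finally show ?thesis .
    qed
    have g0: "0 \<le> g" using ge[OF w] by (simp add: g_def)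
    \<comment> \<open>A quadratic in \<open>t\<close> without constant term and with nonzero linear
      coefficient turns negative for small \<open>t\<close> of the right sign. The value - c / (g +
      1) achieves this for all g \<ge> 0, including g = 0.\<close>
    have "0 \<le> (- c / (g + 1))\<^sup>2 * g + 2 * (- c / (g + 1)) * c" by (rule key)
    also have "\<dots> = (c\<^sup>2 / (g + 1)\<^sup>2) * (g - 2 * (g + 1))"
      using g0 by (simp add: power_divide divide_simps) (simp add: power2_eq_square algebra_simps)
    also have "\<dots> < 0"
      using g0 nz by (intro mult_pos_neg) (auto simp: c_def)
    finally show False by simp
  qed
  have "l *\<^sub>R v - f v \<in> S" using v S by (auto intro!: subspace_diff subspace_scale)
  with orth have "l *\<^sub>R v - f v = 0" by (metis inner_eq_zero_iff)
  then have "f v = l *\<^sub>R v" by simp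
  then show ?thesis using v by blast
qed

text \<open>Induction on the dimension: split off one unit eigenvector; its orthogonal complement in
  \<open>S\<close> is again invariant because \<open>f\<close> is self-adjoint. The spanning
  property is kept as an explicit expansion, from which completeness can be read off.\<close>

lemma selfadjoint_eigenbasis:
  fixes f :: "'a::euclidean_space \<Rightarrow> 'a"
  assumes lin: "linear f" and sa: "\<And>v w. f v \<bullet> w = v \<bullet> f w"
    and S: "subspace S" "f ` S \<subseteq> S"
  shows "\<exists>B. finite B \<and> B \<subseteq> S \<and> pairwise orthogonal B \<and> (\<forall>b\<in>B. norm b = 1 \<and> (\<exists>l. f b = l *\<^sub>R b))
           \<and> (\<forall>w\<in>S. w = (\<Sum>b\<in>B. (w \<bullet> b) *\<^sub>R b))"
  using S
proof (induction "dim S" arbitrary: S rule: less_induct)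
  case (less S)
  show ?case
  proof (cases "S = {0}")
    case True
    then show ?thesis by (intro exI[of _ "{}"]) auto
  next
    case False
    obtain v l where v: "v \<in> S" "norm v = 1" "f v = l *\<^sub>R v"
      using selfadjoint_eigenvector[OF lin sa less.prems False] by blast
    have vv: "v \<bullet> v = 1" using v(2) by (simp add: norm_eq_1)
    define T where "T = S \<inter> {w. v \<bullet> w = 0}"
    have T: "subspace T" unfolding T_def
      by (intro subspace_inter less.prems subspace_hyperplane)
    have fT: "f ` T \<subseteq> T"
    proof
      fix z assume "z \<in> f ` T"
      then obtain w where w: "w \<in> S" "v \<bullet> w = 0" "z = f w" by (auto simp: T_def)
      have "v \<bullet> f w = f v \<bullet> w" by (simp add: sa)
      also have "\<dots> = 0" using w by (simp add: v(3))
      finally show "z \<in> T" using w less.prems by (auto simp: T_def)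
    qed
    have "v \<notin> T" using vv by (simp add: T_def)
    then have "T \<subset> S" using v(1) by (metis T_def inf_le1 psubsetI)
    then have "dim T < dim S"
      using T less.prems by (metis dim_psubset span_eq_iff)
    from less.hyps[OF this T fT] obtain B where B: "finite B" "B \<subseteq> T" "pairwise orthogonal B"
      "\<forall>b\<in>B. norm b = 1 \<and> (\<exists>l. f b = l *\<^sub>R b)" "\<forall>w\<in>T. w = (\<Sum>b\<in>B. (w \<bullet> b) *\<^sub>R b)"
      by blast
    have vB: "v \<notin> B" using B(2) \<open>v \<notin> T\<close> by blast
    have vb: "v \<bullet> b = 0" if "b \<in> B" for b using that B(2) by (auto simp: T_def)
    show ?thesis
    proof (intro exI[of _ "insert v B"] conjI)
      show "pairwise orthogonal (insert v B)"
        using B(3) vb by (auto simp: pairwise_insert orthogonal_def inner_commute)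
      show "\<forall>w\<in>S. w = (\<Sum>b\<in>insert v B. (w \<bullet> b) *\<^sub>R b)"
      proof
        fix w assume w: "w \<in> S"
        let ?r = "w - (w \<bullet> v) *\<^sub>R v"
        have "?r \<in> T" using w v less.prems vv
          by (auto simp: T_def subspace_diff subspace_scale inner_diff_right inner_commute)
        then have "?r = (\<Sum>b\<in>B. (?r \<bullet> b) *\<^sub>R b)" using B(5) by blast
        also have "\<dots> = (\<Sum>b\<in>B. (w \<bullet> b) *\<^sub>R b)"
          by (rule sum.cong) (auto simp: inner_diff_left vb)
        finally show "w = (\<Sum>b\<in>insert v B. (w \<bullet> b) *\<^sub>R b)"
          using B(1) vB by (simp add: algebra_simps)
      qed
    qed (use B v less.prems in \<open>auto simp: T_def\<close>)
  qed
qed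

text \<open>The basis has as many elements as there are vertices, so it can be indexed by the vertex
  type itself and all spectral sums run over \<open>UNIV\<close>. The third relation is the
  expansion of the coordinate vectors.\<close>

lemma symmetric_matrix_eigenbasis:
  fixes M :: "'a::finite \<Rightarrow> 'a \<Rightarrow> real"
  assumes sym: "\<And>v w. M v w = M w v"
  obtains \<psi> :: "'a \<Rightarrow> 'a \<Rightarrow> real" and \<mu> :: "'a \<Rightarrow> real"
  where "\<And>j v. (\<Sum>w\<in>UNIV. M v w * \<psi> j w) = \<mu> j * \<psi> j v"
    and "\<And>i j. (\<Sum>v\<in>UNIV. \<psi> i v * \<psi> j v) = (if i = j then 1 else 0)"
    and "\<And>v w. (\<Sum>j\<in>UNIV. \<psi> j v * \<psi> j w) = (if v = w then 1 else 0)"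
proof -
  define f :: "real^'a \<Rightarrow> real^'a" where "f = (\<lambda>z. \<chi> v. \<Sum>w\<in>UNIV. M v w * z $ w)"
  have lin: "linear f"
    by (rule linearI) (auto simp: f_def vec_eq_iff algebra_simps sum.distrib sum_distrib_left)
  have sa: "f v \<bullet> w = v \<bullet> f w" for v w
  proof -
    have "f v \<bullet> w = (\<Sum>i\<in>UNIV. \<Sum>j\<in>UNIV. M i j * v $ j * w $ i)"
      by (simp add: f_def inner_vec_def sum_distrib_right)
    also have "\<dots> = (\<Sum>j\<in>UNIV. \<Sum>i\<in>UNIV. M i j * v $ j * w $ i)" by (rule sum.swap)
    also have "\<dots> = v \<bullet> f w"
      by (simp add: f_def inner_vec_def sum_distrib_left sym mult_ac)
    finally show ?thesis .
  qed
  obtain B where B: "finite B" "pairwise orthogonal B"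
      "\<forall>b\<in>B. norm b = 1 \<and> (\<exists>l. f b = l *\<^sub>R b)" "\<forall>w. w = (\<Sum>b\<in>B. (w \<bullet> b) *\<^sub>R b)"
    using selfadjoint_eigenbasis[OF lin sa, of UNIV] by auto
  have "independent B"
    by (rule pairwise_orthogonal_independent) (use B in auto)
  moreover have "span B = UNIV"
  proof -
    have "w \<in> span B" for w
    proof -
      have "(\<Sum>b\<in>B. (w \<bullet> b) *\<^sub>R b) \<in> span B"
        by (intro span_sum span_scale span_base)
      then show ?thesis using B(4) by metis
    qed
    then show ?thesis by auto
  qed
  ultimately have "card B = CARD('a)"
    by (metis dim_UNIV dim_span dim_eq_card_independent DIM_cart DIM_real mult_1_right)
  then obtain h :: "'a \<Rightarrow> real^'a" where h: "bij_betw h UNIV B"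
    using finite_same_card_bij[of "UNIV :: 'a set" B] B(1) by auto
  have hB: "h j \<in> B" for j using h by (auto simp: bij_betw_def)
  from B(3) hB have "\<forall>j. \<exists>l. f (h j) = l *\<^sub>R h j" by blast
  then obtain \<mu> where \<mu>: "\<And>j. f (h j) = \<mu> j *\<^sub>R h j" by metis
  show thesis
  proof
    fix j v
    show "(\<Sum>w\<in>UNIV. M v w * h j $ w) = \<mu> j * h j $ v"
      using arg_cong[OF \<mu>[of j], of "\<lambda>z. z $ v"] by (simp add: f_def)
  next
    fix i j
    have "h i \<bullet> h j = (if i = j then 1 else 0)"
    proof (cases "i = j")
      case True
      then show ?thesis using B(3) hB by (simp add: norm_eq_1)
    next
      case False
      then have "h i \<noteq> h j" using h by (auto simp: bij_betw_def inj_def)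
      then show ?thesis using False B(2) hB by (auto simp: pairwise_def orthogonal_def)
    qed
    then show "(\<Sum>v\<in>UNIV. h i $ v * h j $ v) = (if i = j then 1 else 0)"
      by (simp add: inner_vec_def)
  next
    fix v w
    have "axis v 1 = (\<Sum>b\<in>B. (axis v 1 \<bullet> b) *\<^sub>R b)" using B(4) by blast
    also have "\<dots> = (\<Sum>j\<in>UNIV. (axis v 1 \<bullet> h j) *\<^sub>R h j)"
      by (rule sum.reindex_bij_betw[OF h, symmetric])
    finally have "axis v 1 $ w = (\<Sum>j\<in>UNIV. (axis v 1 \<bullet> h j) *\<^sub>R h j) $ w" by simp
    then show "(\<Sum>j\<in>UNIV. h j $ v * h j $ w) = (if v = w then 1 else 0)"
      by (simp add: inner_axis') (auto simp: axis_def)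
  qed
qed

lemma mat_pow_eigenbasis:
  fixes M :: "'a::finite \<Rightarrow> 'a \<Rightarrow> real"
  assumes eig: "\<And>j v. (\<Sum>w\<in>UNIV. M v w * \<psi> j w) = \<mu> j * \<psi> j v"
    and compl: "\<And>v w. (\<Sum>j\<in>UNIV. \<psi> j v * \<psi> j w) = (if v = w then 1 else 0)"
  shows "mat_pow (\<lambda>a b. complex_of_real (M a b)) k v u
           = (\<Sum>j\<in>UNIV. complex_of_real (\<mu> j) ^ k * complex_of_real (\<psi> j v * \<psi> j u))"
proof (induction k arbitrary: v)
  case 0
  show ?case by (simp add: compl flip: of_real_sum of_real_mult)
next
  case (Suc k)
  have "mat_pow (\<lambda>a b. complex_of_real (M a b)) (Suc k) v u
     = (\<Sum>w\<in>UNIV. \<Sum>j\<in>UNIV. complex_of_real (M v w) * (complex_of_real (\<mu> j) ^ k * complex_of_real (\<psi> j w * \<psi> j u)))"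
    by (simp add: mat_mult_def Suc sum_distrib_left)
  also have "\<dots> = (\<Sum>j\<in>UNIV. \<Sum>w\<in>UNIV. complex_of_real (M v w) * (complex_of_real (\<mu> j) ^ k * complex_of_real (\<psi> j w * \<psi> j u)))"
    by (rule sum.swap)
  also have "\<dots> = (\<Sum>j\<in>UNIV. complex_of_real (\<mu> j) ^ k * complex_of_real (\<psi> j u) * complex_of_real (\<Sum>w\<in>UNIV. M v w * \<psi> j w))"
    by (simp add: sum_distrib_left mult_ac)
  finally show ?case by (simp add: eig mult_ac)
qed

text \<open>In each eigendirection the matrix series becomes a scalar exponential series; the sum
  over eigenvectors is finite and commutes with the series.\<close>

lemma state_eigenbasis:
  assumes eig: "\<And>j v. (\<Sum>w\<in>UNIV. hamiltonian E W Q v w * \<psi> j w) = \<mu> j * \<psi> j v"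
    and compl: "\<And>v w. (\<Sum>j\<in>UNIV. \<psi> j v * \<psi> j w) = (if v = w then 1 else 0)"
  shows "state E W Q u t v = (\<Sum>j\<in>UNIV. cis (t * \<mu> j) * complex_of_real (\<psi> j v * \<psi> j u))"
proof -
  have "(\<lambda>k. (\<i> * complex_of_real (t * \<mu> j)) ^ k / of_nat (fact k) * complex_of_real (\<psi> j v * \<psi> j u))
        sums (cis (t * \<mu> j) * complex_of_real (\<psi> j v * \<psi> j u))" for j
    using sums_mult2[OF exp_converges[of "\<i> * complex_of_real (t * \<mu> j)"], of "complex_of_real (\<psi> j v * \<psi> j u)"]
    by (simp add: cis_conv_exp scaleR_conv_of_real divide_inverse mult_ac)
  then have "(\<lambda>k. \<Sum>j\<in>UNIV. (\<i> * complex_of_real (t * \<mu> j)) ^ k / of_nat (fact k) * complex_of_real (\<psi> j v * \<psi> j u))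
        sums (\<Sum>j\<in>UNIV. cis (t * \<mu> j) * complex_of_real (\<psi> j v * \<psi> j u))"
    by (intro sums_sum)
  moreover have "(\<Sum>j\<in>UNIV. (\<i> * complex_of_real (t * \<mu> j)) ^ k / of_nat (fact k) * complex_of_real (\<psi> j v * \<psi> j u))
      = (\<i> * complex_of_real t) ^ k / of_nat (fact k)
        * mat_pow (\<lambda>a b. complex_of_real (hamiltonian E W Q a b)) k v u" for k
    by (simp only: mat_pow_eigenbasis[OF eig compl] sum_distrib_left)
       (simp add: power_mult_distrib mult_ac)
  ultimately show ?thesis unfolding state_def by (simp add: sums_iff)
qed

section \<open>Two-level oscillations\<close>

lemma cmod_cis_minus_1_le: "cmod (cis a - 1) \<le> \<bar>a\<bar>"
proof -
  have "(cmod (cis a - 1))\<^sup>2 = (cos a - 1)\<^sup>2 + (sin a)\<^sup>2"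
    by (simp add: cmod_def)
  also have "\<dots> = 2 - 2 * cos a"
    using sin_cos_squared_add[of a] by (simp add: power2_eq_square algebra_simps)
  also have "\<dots> = (2 * sin (a / 2))\<^sup>2"
    using cos_double_sin[of "a / 2"] by (simp add: power2_eq_square)
  \<comment> \<open>The chord of angle \<open>a\<close> has length 2 |sin (a / 2)|, which is at most
    the arc.\<close>
  finally have "cmod (cis a - 1) = \<bar>2 * sin (a / 2)\<bar>"
    by (metis norm_ge_zero power2_eq_iff_nonneg real_sqrt_abs real_sqrt_unique)
  then show ?thesis using abs_sin_le_one abs_sin_x_le_abs_x[of "a / 2"] by simp
qed

lemma cmod_cis_minus_1_le_2: "cmod (cis a - 1) \<le> 2"
  using norm_triangle_ineq4[of "cis a" 1] by simp

text \<open>Abstract two-level oscillation: \<open>F Q t\<close> will be the modulus of the state at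
  the target well, \<open>s\<close> the amplitude, \<open>g\<close> the eigenvalue gap and
  \<open>e\<close> a vanishing error.\<close>

context
  fixes F :: "real \<Rightarrow> real \<Rightarrow> real" and s g e :: "real \<Rightarrow> real" and \<kappa> :: real
  assumes F_nonneg: "\<And>Q t. 0 \<le> F Q t"
    and approx: "eventually (\<lambda>Q. \<forall>t\<ge>0. \<bar>F Q t - s Q * cmod (cis (t * g Q) - 1)\<bar> \<le> e Q) at_top"
    and s_nonneg: "eventually (\<lambda>Q. 0 \<le> s Q) at_top"
    and s_lim: "(s \<longlongrightarrow> \<kappa>) at_top"
    and e_lim: "(e \<longlongrightarrow> 0) at_top"
begin

lemma two_level_sup_le:
  "eventually (\<lambda>Q. (SUP t\<in>{0..}. ereal ((F Q t)\<^sup>2)) \<le> ereal ((2 * s Q + e Q)\<^sup>2)) at_top"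
  using approx s_nonneg
proof eventually_elim
  case (elim Q)
  show ?case
  proof (rule SUP_least)
    fix t :: real assume "t \<in> {0..}"
    then have "F Q t \<le> s Q * cmod (cis (t * g Q) - 1) + e Q" using elim by (force simp: abs_le_iff)
    also have "s Q * cmod (cis (t * g Q) - 1) \<le> s Q * 2"
      by (intro mult_left_mono cmod_cis_minus_1_le_2 elim)
    finally show "ereal ((F Q t)\<^sup>2) \<le> ereal ((2 * s Q + e Q)\<^sup>2)"
      using F_nonneg[of Q t] by (auto intro!: power_mono)
  qed
qed

lemma two_level_upper_lim: "((\<lambda>Q. ereal ((2 * s Q + e Q)\<^sup>2)) \<longlongrightarrow> ereal (4 * \<kappa>\<^sup>2)) at_top"
proof -
  have "((\<lambda>Q. (2 * s Q + e Q)\<^sup>2) \<longlongrightarrow> (2 * \<kappa> + 0)\<^sup>2) at_top"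
    by (intro tendsto_intros s_lim e_lim)
  then show ?thesis by (simp add: power_mult_distrib)
qed

text \<open>The supremum is squeezed between (2 s - e)^2, attained up to error at the half period pi
  / |g|, and (2 s + e)^2. Only membership of the half period in \<open>T Q\<close> matters, so the
  same lemma serves unbounded and bounded time ranges.\<close>

lemma two_level_Liminf:
  assumes g: "eventually (\<lambda>Q. g Q \<noteq> 0 \<and> pi / \<bar>g Q\<bar> \<in> T Q \<and> T Q \<subseteq> {0..}) at_top"
    and \<kappa>: "\<kappa> > 0"
  shows "Liminf at_top (\<lambda>Q. SUP t\<in>T Q. ereal ((F Q t)\<^sup>2)) = ereal (4 * \<kappa>\<^sup>2)"
proof -
  have "((\<lambda>Q. 2 * s Q - e Q) \<longlongrightarrow> 2 * \<kappa> - 0) at_top"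
    by (intro tendsto_intros s_lim e_lim)
  from order_tendstoD(1)[OF this, of 0] have pos: "eventually (\<lambda>Q. 0 < 2 * s Q - e Q) at_top"
    using \<kappa> by simp
  have "((\<lambda>Q. (2 * s Q - e Q)\<^sup>2) \<longlongrightarrow> (2 * \<kappa> - 0)\<^sup>2) at_top"
    by (intro tendsto_intros s_lim e_lim)
  then have lower_lim: "((\<lambda>Q. ereal ((2 * s Q - e Q)\<^sup>2)) \<longlongrightarrow> ereal (4 * \<kappa>\<^sup>2)) at_top"
    by (simp add: power_mult_distrib)
  have lower: "eventually (\<lambda>Q. ereal ((2 * s Q - e Q)\<^sup>2) \<le> (SUP t\<in>T Q. ereal ((F Q t)\<^sup>2))) at_top"
    using approx g pos
  proof eventually_elim
    case (elim Q)
    define t where "t = pi / \<bar>g Q\<bar>"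
    have "t * g Q = pi \<or> t * g Q = - pi"
      using elim by (auto simp: t_def abs_if)
    then have "cis (t * g Q) = -1" by (auto simp: complex_eq_iff)
    then have "cmod (cis (t * g Q) - 1) = 2" by simp
    moreover have "\<bar>F Q t - s Q * cmod (cis (t * g Q) - 1)\<bar> \<le> e Q"
      using elim by (auto simp: t_def)
    ultimately have "2 * s Q - e Q \<le> F Q t" by (simp add: abs_le_iff)
    then have "(2 * s Q - e Q)\<^sup>2 \<le> (F Q t)\<^sup>2" using elim by (intro power_mono) auto
    then show ?case using elim by (intro SUP_upper2[of t]) (auto simp: t_def)
  qed
  have upper: "eventually (\<lambda>Q. (SUP t\<in>T Q. ereal ((F Q t)\<^sup>2)) \<le> ereal ((2 * s Q + e Q)\<^sup>2)) at_top"
    using two_level_sup_le g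
  proof eventually_elim
    case (elim Q)
    have "(SUP t\<in>T Q. ereal ((F Q t)\<^sup>2)) \<le> (SUP t\<in>{0..}. ereal ((F Q t)\<^sup>2))"
      by (rule SUP_subset_mono) (use elim in auto)
    then show ?case using elim by order
  qed
  show ?thesis
    by (intro lim_imp_Liminf tendsto_sandwich[OF lower upper lower_lim two_level_upper_lim]) auto
qed

text \<open>A vanishing amplitude is decisive by itself: the upper bound tends to 0 whatever the gap
  does.\<close>

lemma two_level_Liminf_zero:
  assumes "\<kappa> = 0"
  shows "Liminf at_top (\<lambda>Q. SUP t\<in>{0..}. ereal ((F Q t)\<^sup>2)) = 0"
proof -
  have "eventually (\<lambda>Q. 0 \<le> (SUP t\<in>{0..}. ereal ((F Q t)\<^sup>2))) at_top"
    by (auto intro!: always_eventually SUP_upper2[of 0])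
  then have "((\<lambda>Q. SUP t\<in>{0..}. ereal ((F Q t)\<^sup>2)) \<longlongrightarrow> 0) at_top"
    using two_level_upper_lim assms
    by (intro tendsto_sandwich[OF _ two_level_sup_le tendsto_const]) (auto simp: zero_ereal_def)
  then show ?thesis by (intro lim_imp_Liminf) auto
qed

text \<open>Up to time \<open>f Q\<close> the phase t g turns by at most f |g|, which tends to 0, so
  the oscillation has not begun. The conclusion is an inequality because \<open>f Q\<close> may be
  negative, and then the supremum over the empty set is minus infinity.\<close>

lemma two_level_Liminf_short_time:
  assumes g: "eventually (\<lambda>Q. \<bar>g Q\<bar> * Q ^ n \<le> c) at_top"
    and f: "f \<in> o[at_top](\<lambda>Q. Q ^ n)"
  shows "Liminf at_top (\<lambda>Q. SUP t\<in>{0..f Q}. ereal ((F Q t)\<^sup>2)) \<le> 0"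
proof -
  have fg: "((\<lambda>Q. f Q * \<bar>g Q\<bar>) \<longlongrightarrow> 0) at_top"
  proof -
    have "((\<lambda>Q. f Q / Q ^ n) \<longlongrightarrow> 0) at_top" by (rule smalloD_tendsto[OF f])
    then have "((\<lambda>Q. \<bar>f Q / Q ^ n\<bar> * c) \<longlongrightarrow> 0) at_top"
      by (intro tendsto_mult_left_zero tendsto_rabs_zero)
    moreover have "eventually (\<lambda>Q. norm (f Q * \<bar>g Q\<bar>) \<le> \<bar>f Q / Q ^ n\<bar> * c) at_top"
      using g eventually_gt_at_top[of 0]
    proof eventually_elim
      case (elim Q)
      have "norm (f Q * \<bar>g Q\<bar>) = \<bar>f Q / Q ^ n\<bar> * (\<bar>g Q\<bar> * Q ^ n)"
        using elim by (simp add: abs_mult)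
      also have "\<dots> \<le> \<bar>f Q / Q ^ n\<bar> * c" using elim by (intro mult_left_mono) auto
      finally show ?case .
    qed
    ultimately show ?thesis by (rule Lim_null_comparison[rotated])
  qed
  have "((\<lambda>Q. (s Q * (f Q * \<bar>g Q\<bar>) + e Q)\<^sup>2) \<longlongrightarrow> (\<kappa> * 0 + 0)\<^sup>2) at_top"
    by (intro tendsto_intros s_lim e_lim fg)
  then have lim: "((\<lambda>Q. ereal ((s Q * (f Q * \<bar>g Q\<bar>) + e Q)\<^sup>2)) \<longlongrightarrow> 0) at_top"
    by (simp add: zero_ereal_def)
  have "eventually (\<lambda>Q. (SUP t\<in>{0..f Q}. ereal ((F Q t)\<^sup>2)) \<le> ereal ((s Q * (f Q * \<bar>g Q\<bar>) + e Q)\<^sup>2)) at_top"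
    using approx s_nonneg
  proof eventually_elim
    case (elim Q)
    show ?case
    proof (rule SUP_least)
      fix t assume t: "t \<in> {0..f Q}"
      then have "F Q t \<le> s Q * cmod (cis (t * g Q) - 1) + e Q" using elim by (force simp: abs_le_iff)
      also have "cmod (cis (t * g Q) - 1) \<le> \<bar>t * g Q\<bar>" by (rule cmod_cis_minus_1_le)
      also have "\<bar>t * g Q\<bar> \<le> f Q * \<bar>g Q\<bar>" using t by (simp add: abs_mult mult_right_mono)
      finally show "ereal ((F Q t)\<^sup>2) \<le> ereal ((s Q * (f Q * \<bar>g Q\<bar>) + e Q)\<^sup>2)"
        using F_nonneg[of Q t] elim by (auto intro!: power_mono simp: mult_left_mono)
    qed
  qed
  then have "Liminf at_top (\<lambda>Q. SUP t\<in>{0..f Q}. ereal ((F Q t)\<^sup>2))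
      \<le> Liminf at_top (\<lambda>Q. ereal ((s Q * (f Q * \<bar>g Q\<bar>) + e Q)\<^sup>2))"
    by (rule Liminf_mono)
  also have "\<dots> = 0" using lim by (intro lim_imp_Liminf) auto
  finally show ?thesis .
qed

end

section \<open>Excursions from the wells\<close>

lemma mat_pow_nonneg:
  fixes A :: "'a::finite \<Rightarrow> 'a \<Rightarrow> real"
  assumes "\<And>v w. 0 \<le> A v w"
  shows "0 \<le> mat_pow A k v w"
  by (induction k arbitrary: v) (auto simp: mat_mult_def assms intro!: sum_nonneg)

locale double_well =
  fixes A :: "'a::finite \<Rightarrow> 'a \<Rightarrow> real" and x y :: 'a
  assumes A_sym: "A v w = A w v" and A_nonneg: "0 \<le> A v w" and A_le_1: "A v w \<le> 1"
    and x_neq_y: "x \<noteq> y"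
begin

text \<open>This is the identity minus the Hamiltonian, written with the normalized adjacency: an
  eigenvalue \<mu> of \<open>K Q\<close> corresponds to 1 - \<mu> of the Hamiltonian, and the well
  states sit near +Q.\<close>

definition K :: "real \<Rightarrow> 'a \<Rightarrow> 'a \<Rightarrow> real" where
  "K Q v w = A v w + (if v = w \<and> (v = x \<or> v = y) then Q else 0)"

text \<open>Total weight of the walks of length \<open>k\<close> from \<open>z\<close> to \<open>v\<close> that avoid both wells after the start;
  \<open>first_hit z k v\<close> adds one unrestricted step, so it belongs to walks of length \<open>k + 1\<close>.\<close>

fun excursion :: "'a \<Rightarrow> nat \<Rightarrow> 'a \<Rightarrow> real" where
  "excursion z 0 v = (if v = z then 1 else 0)"
| "excursion z (Suc k) v = (if v = x \<or> v = y then 0 else (\<Sum>w\<in>UNIV. A v w * excursion z k w))"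

definition first_hit :: "'a \<Rightarrow> nat \<Rightarrow> 'a \<Rightarrow> real" where
  "first_hit z k v = (\<Sum>w\<in>UNIV. A v w * excursion z k w)"

lemma K_sym: "K Q v w = K Q w v"
  by (auto simp: K_def A_sym[of v w])

lemma K_apply: "(\<Sum>w\<in>UNIV. K Q v w * \<phi> w) = (\<Sum>w\<in>UNIV. A v w * \<phi> w) + (if v = x \<or> v = y then Q * \<phi> v else 0)"
proof -
  have "(\<Sum>w\<in>UNIV. K Q v w * \<phi> w)
      = (\<Sum>w\<in>UNIV. A v w * \<phi> w + (if v = w then (if v = x \<or> v = y then Q * \<phi> v else 0) else 0))"
    by (intro sum.cong) (auto simp: K_def algebra_simps)
  then show ?thesis by (simp add: sum.distrib)
qed

lemma excursion_nonneg: "0 \<le> excursion z k v"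
  by (induction k arbitrary: v) (auto intro!: sum_nonneg mult_nonneg_nonneg A_nonneg)

lemma excursion_le: "excursion z k v \<le> real CARD('a) ^ k"
proof (induction k arbitrary: v)
  case (Suc k)
  have "(\<Sum>w\<in>UNIV. A v w * excursion z k w) \<le> (\<Sum>w\<in>(UNIV::'a set). 1 * real CARD('a) ^ k)"
    by (intro sum_mono mult_mono Suc A_le_1 excursion_nonneg) auto
  then show ?case by simp
qed simp

lemma excursion_Suc: "excursion z (Suc k) v = (if v = x \<or> v = y then 0 else first_hit z k v)"
  by (simp add: first_hit_def)

text \<open>Renewal decomposition: as long as the other well \<open>z'\<close> is out of reach, a walk from \<open>z\<close>
  is a closed walk at \<open>z\<close> followed by an excursion.\<close>

lemma mat_pow_renewal:
  assumes z: "{z, z'} = {x, y}"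
    and unreachable: "\<And>k. k < d \<Longrightarrow> mat_pow A k z' z = 0"
  shows "n < d \<Longrightarrow> mat_pow A n v z = (\<Sum>k\<le>n. mat_pow A (n - k) z z * excursion z k v)"
proof (induction n arbitrary: v)
  case 0
  then show ?case by simp
next
  case (Suc n)
  have zz': "z \<noteq> z'" using z x_neq_y by (metis doubleton_eq_iff insert_absorb2)
  have step: "mat_pow A (Suc n) v z = (\<Sum>k\<le>n. mat_pow A (n - k) z z * first_hit z k v)"
  proof -
    have "mat_pow A (Suc n) v z = (\<Sum>w\<in>UNIV. \<Sum>k\<le>n. A v w * (mat_pow A (n - k) z z * excursion z k w))"
      using Suc by (simp add: mat_mult_def sum_distrib_left)
    also have "\<dots> = (\<Sum>k\<le>n. \<Sum>w\<in>UNIV. A v w * (mat_pow A (n - k) z z * excursion z k w))"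
      by (rule sum.swap)
    finally show ?thesis by (simp add: first_hit_def sum_distrib_left mult_ac)
  qed
  have split: "(\<Sum>k\<le>Suc n. mat_pow A (Suc n - k) z z * excursion z k v)
      = mat_pow A (Suc n) z z * excursion z 0 v + (\<Sum>k\<le>n. mat_pow A (n - k) z z * excursion z (Suc k) v)"
    by (simp only: sum.atMost_Suc_shift diff_Suc_Suc diff_zero)
  \<comment> \<open>At the start well all excursions of positive length vanish; at the other well
    both sides vanish by unreachability; elsewhere the last step of the walk extends an
    excursion.\<close>
  consider "v = z" | "v = z'" | "v \<noteq> x" "v \<noteq> y" using z by blast
  then show ?case
  proof cases
    case 1
    have "v = x \<or> v = y" using 1 z by blast
    then show ?thesis using 1 unfolding split by (simp del: mat_pow.simps)
  next
    case 2
    have "v = x \<or> v = y" using 2 z by blast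
    then show ?thesis using 2 zz' unreachable[OF Suc.prems] unfolding split by (simp del: mat_pow.simps)
  next
    case 3
    have "v \<noteq> z" using 3 z by blast
    then show ?thesis using 3 unfolding split step by (simp add: excursion_Suc del: excursion.simps(2))
  qed
qed

text \<open>The renewal decomposition followed by one free step. It thereby reaches length
  \<open>d\<close>, where the other well may be hit for the first time.\<close>

lemma mat_pow_Suc_renewal:
  assumes z: "{z, z'} = {x, y}"
    and unreachable: "\<And>k. k < d \<Longrightarrow> mat_pow A k z' z = 0" and n: "n < d"
  shows "mat_pow A (Suc n) v z = (\<Sum>k\<le>n. mat_pow A (n - k) z z * first_hit z k v)"
proof -
  have "mat_pow A (Suc n) v z = (\<Sum>w\<in>UNIV. \<Sum>k\<le>n. A v w * (mat_pow A (n - k) z z * excursion z k w))"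
    by (simp add: mat_mult_def sum_distrib_left mat_pow_renewal[OF z unreachable n])
  also have "\<dots> = (\<Sum>k\<le>n. \<Sum>w\<in>UNIV. A v w * (mat_pow A (n - k) z z * excursion z k w))"
    by (rule sum.swap)
  finally show ?thesis by (simp add: first_hit_def sum_distrib_left mult_ac)
qed

text \<open>In the renewal sum the earlier first hits vanish by induction, which leaves the term
  with the closed walk of length 0. Hence these weights are zero for n < d - 1 and equal the weight
  of the shortest walks at n = d - 1.\<close>

lemma first_hit_other_well:
  assumes z: "{z, z'} = {x, y}"
    and unreachable: "\<And>k. k < d \<Longrightarrow> mat_pow A k z' z = 0" and n: "n < d"
  shows "first_hit z n z' = mat_pow A (Suc n) z' z"
  using n
proof (induction n rule: less_induct)
  case (less n)
  have "first_hit z k z' = 0" if "k < n" for k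
    using less.IH[OF that] unreachable[of "Suc k"] that less.prems by simp
  then have "(\<Sum>k<n. mat_pow A (n - k) z z * first_hit z k z') = 0"
    by (intro sum.neutral) auto
  with mat_pow_Suc_renewal[OF z unreachable less.prems, of z'] show ?case
    by (simp add: lessThan_Suc_atMost[symmetric] del: mat_pow.simps(2))
qed

text \<open>The renewal equation is triangular: the return weight of length n + 1 is
  \<open>first_hit z n z\<close> plus an expression in shorter returns and earlier first hits. Equal
  returns therefore determine equal first hits, one length at a time.\<close>

lemma first_hit_eq_of_cospectral:
  assumes un: "\<And>k. k < d \<Longrightarrow> mat_pow A k y x = 0" "\<And>k. k < d \<Longrightarrow> mat_pow A k x y = 0"
    and m: "m \<le> d" and co: "\<And>k. k \<le> m \<Longrightarrow> mat_pow A k x x = mat_pow A k y y"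
  shows "k < m \<Longrightarrow> first_hit x k x = first_hit y k y"
proof (induction k rule: less_induct)
  case (less n)
  have 1: "mat_pow A (Suc n) x x = (\<Sum>k<n. mat_pow A (n - k) x x * first_hit x k x) + first_hit x n x"
    using mat_pow_Suc_renewal[of x y d n x] un(1) less.prems m
    by (simp add: lessThan_Suc_atMost[symmetric] del: mat_pow.simps(2))
  have 2: "mat_pow A (Suc n) y y = (\<Sum>k<n. mat_pow A (n - k) y y * first_hit y k y) + first_hit y n y"
    using mat_pow_Suc_renewal[of y x d n y] un(2) less.prems m
    by (simp add: lessThan_Suc_atMost[symmetric] insert_commute del: mat_pow.simps(2))
  have "(\<Sum>k<n. mat_pow A (n - k) x x * first_hit x k x) = (\<Sum>k<n. mat_pow A (n - k) y y * first_hit y k y)"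
    using less by (intro sum.cong) (auto simp: co)
  with 1 2 co[of "Suc n"] less.prems show ?case by simp
qed

text \<open>One length beyond the known agreement, all lower-order terms of the two renewal
  equations cancel, so the first discrepancy of returns is exactly that of first returns.\<close>

lemma first_hit_diff_of_cospectral:
  assumes un: "\<And>k. k < d \<Longrightarrow> mat_pow A k y x = 0" "\<And>k. k < d \<Longrightarrow> mat_pow A k x y = 0"
    and m: "m < d" and co: "\<And>k. k \<le> m \<Longrightarrow> mat_pow A k x x = mat_pow A k y y"
  shows "first_hit x m x - first_hit y m y = mat_pow A (Suc m) x x - mat_pow A (Suc m) y y"
proof -
  have 1: "mat_pow A (Suc m) x x = (\<Sum>k<m. mat_pow A (m - k) x x * first_hit x k x) + first_hit x m x"
    using mat_pow_Suc_renewal[of x y d m x] un(1) m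
    by (simp add: lessThan_Suc_atMost[symmetric] del: mat_pow.simps(2))
  have 2: "mat_pow A (Suc m) y y = (\<Sum>k<m. mat_pow A (m - k) y y * first_hit y k y) + first_hit y m y"
    using mat_pow_Suc_renewal[of y x d m y] un(2) m
    by (simp add: lessThan_Suc_atMost[symmetric] insert_commute del: mat_pow.simps(2))
  have "(\<Sum>k<m. mat_pow A (m - k) x x * first_hit x k x) = (\<Sum>k<m. mat_pow A (m - k) y y * first_hit y k y)"
    using m first_hit_eq_of_cospectral[of d m, OF un _ co] by (intro sum.cong) (auto simp: co)
  with 1 2 show ?thesis by simp
qed

end

section \<open>Eliminating the vertices outside the wells\<close>

context double_well
begin

definition eigenpair :: "real \<Rightarrow> ('a \<Rightarrow> real) \<Rightarrow> real \<Rightarrow> bool" where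
  "eigenpair Q \<psi> \<mu> \<longleftrightarrow> (\<forall>v. (\<Sum>w\<in>UNIV. K Q v w * \<psi> w) = \<mu> * \<psi> v) \<and> (\<Sum>v\<in>UNIV. (\<psi> v)\<^sup>2) = 1"

lemma CARD_ge_1: "1 \<le> real CARD('a)"
  by (simp add: Suc_leI)

lemma eigenpair_abs_le_1:
  assumes "eigenpair Q \<psi> \<mu>" shows "\<bar>\<psi> v\<bar> \<le> 1"
proof -
  have "(\<psi> v)\<^sup>2 \<le> (\<Sum>v\<in>UNIV. (\<psi> v)\<^sup>2)" by (rule member_le_sum) auto
  then show ?thesis using assms by (simp add: eigenpair_def abs_square_le_1)
qed

lemma eigenpair_mult_le:
  assumes "eigenpair Q \<psi> \<mu>" "\<bar>r\<bar> \<le> c" shows "\<bar>\<psi> v * r\<bar> \<le> c"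
proof -
  have "\<bar>\<psi> v\<bar> * \<bar>r\<bar> \<le> 1 * c"
    using assms by (intro mult_mono eigenpair_abs_le_1[OF assms(1)]) auto
  then show ?thesis by (simp add: abs_mult)
qed

lemma eigenpair_A_bound:
  assumes "eigenpair Q \<psi> \<mu>" shows "\<bar>\<Sum>w\<in>UNIV. A v w * \<psi> w\<bar> \<le> real CARD('a)"
proof -
  have "\<bar>\<Sum>w\<in>UNIV. A v w * \<psi> w\<bar> \<le> (\<Sum>w\<in>UNIV. \<bar>A v w * \<psi> w\<bar>)" by (rule sum_abs)
  also have "\<dots> \<le> (\<Sum>w\<in>(UNIV::'a set). 1 * 1)"
    unfolding abs_mult
    by (intro sum_mono mult_mono eigenpair_abs_le_1[OF assms]) (auto simp: A_nonneg A_le_1)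
  finally show ?thesis by simp
qed

text \<open>Solved for the entry at \<open>v\<close>, this reads \<mu> \<psi> v = (A \<psi>) v off
  the wells and (\<mu> - Q) \<psi> v = (A \<psi>) v on them. As A \<psi> is bounded, eigenvectors
  with \<mu> > Q / 2 are small off the wells and the others are small on them.\<close>

lemma eigenpair_apply:
  assumes "eigenpair Q \<psi> \<mu>"
  shows "(\<Sum>w\<in>UNIV. A v w * \<psi> w) + (if v = x \<or> v = y then Q * \<psi> v else 0) = \<mu> * \<psi> v"
  using assms unfolding eigenpair_def K_apply by blast

lemma eigenpair_off_wells:
  assumes "eigenpair Q \<psi> \<mu>" "v \<noteq> x" "v \<noteq> y" "0 < Q" "Q / 2 < \<mu>"
  shows "\<bar>\<psi> v\<bar> \<le> 2 * real CARD('a) / Q"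
proof -
  have "\<mu> * \<psi> v = (\<Sum>w\<in>UNIV. A v w * \<psi> w)"
    using eigenpair_apply[OF assms(1), of v] assms by simp
  then have "\<mu> * \<bar>\<psi> v\<bar> \<le> real CARD('a)"
    using eigenpair_A_bound[OF assms(1), of v] assms by (metis abs_mult abs_of_pos divide_pos_pos less_trans zero_less_numeral)
  moreover have "Q / 2 * \<bar>\<psi> v\<bar> \<le> \<mu> * \<bar>\<psi> v\<bar>"
    using assms by (intro mult_right_mono) auto
  ultimately have "Q / 2 * \<bar>\<psi> v\<bar> \<le> real CARD('a)" by linarith
  then show ?thesis using assms by (simp add: field_simps)
qed

lemma eigenpair_wells:
  assumes "eigenpair Q \<psi> \<mu>" "v = x \<or> v = y"
  shows "\<bar>\<mu> - Q\<bar> * \<bar>\<psi> v\<bar> \<le> real CARD('a)"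
proof -
  have "(\<mu> - Q) * \<psi> v = (\<Sum>w\<in>UNIV. A v w * \<psi> w)"
    using eigenpair_apply[OF assms(1), of v] assms by (simp add: left_diff_distrib)
  then show ?thesis using eigenpair_A_bound[OF assms(1), of v] by (metis abs_mult)
qed

lemma eigenpair_low:
  assumes "eigenpair Q \<psi> \<mu>" "v = x \<or> v = y" "0 < Q" "\<mu> \<le> Q / 2"
  shows "\<bar>\<psi> v\<bar> \<le> 2 * real CARD('a) / Q"
proof -
  have "Q / 2 * \<bar>\<psi> v\<bar> \<le> \<bar>\<mu> - Q\<bar> * \<bar>\<psi> v\<bar>"
    using assms by (intro mult_right_mono) auto
  then have "Q / 2 * \<bar>\<psi> v\<bar> \<le> real CARD('a)" using eigenpair_wells[OF assms(1,2)] by linarith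
  then show ?thesis using assms by (simp add: field_simps)
qed

lemma sum_split_wells:
  fixes g :: "'a \<Rightarrow> real"
  shows "(\<Sum>v\<in>UNIV. g v) = g x + g y + (\<Sum>v\<in>-{x,y}. g v)"
proof -
  have "(\<Sum>v\<in>UNIV. g v) = (\<Sum>v\<in>{x,y}. g v) + (\<Sum>v\<in>-{x,y}. g v)"
    using sum.union_disjoint[of "{x,y}" "-{x,y}" g] by (simp add: Compl_partition)
  then show ?thesis using x_neq_y by simp
qed

lemma eigenpair_off_sum_bound:
  assumes "eigenpair Q \<psi> \<mu>" "0 < Q" "Q / 2 < \<mu>" and M: "\<And>v. \<bar>g v\<bar> \<le> M"
  shows "\<bar>\<Sum>v\<in>-{x,y}. \<psi> v * g v\<bar> \<le> 2 * (real CARD('a))\<^sup>2 * M / Q"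
proof -
  have M0: "0 \<le> M" using M[of x] by linarith
  have "\<bar>\<Sum>v\<in>-{x,y}. \<psi> v * g v\<bar> \<le> (\<Sum>v\<in>-{x,y}. \<bar>\<psi> v\<bar> * \<bar>g v\<bar>)"
    unfolding abs_mult[symmetric] by (rule sum_abs)
  also have "\<dots> \<le> (\<Sum>v\<in>-{x,y}. (2 * real CARD('a) / Q) * M)"
    using assms by (intro sum_mono mult_mono eigenpair_off_wells[OF assms(1)]) auto
  also have "\<dots> \<le> (\<Sum>v\<in>(UNIV::'a set). (2 * real CARD('a) / Q) * M)"
    using M0 assms by (intro sum_mono2) auto
  also have "\<dots> = 2 * (real CARD('a))\<^sup>2 * M / Q" by (simp add: power2_eq_square)
  finally show ?thesis .
qed

text \<open>The Neumann series of the resolvent of \<open>A\<close> off the wells at energy \<open>l\<close>, cut off at walk length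
  \<open>d\<close>: outside the wells it is an eigenvector of \<open>K Q\<close> for \<open>l\<close> up to order \<open>l\<^bsup>-(d-1)\<^esup>\<close>.\<close>

definition trial :: "nat \<Rightarrow> real \<Rightarrow> 'a \<Rightarrow> 'a \<Rightarrow> real" where
  "trial d l z v = (\<Sum>k<d. excursion z k v / l ^ k)"

lemma trial_wells:
  assumes "{z, z'} = {x, y}" "0 < d"
  shows "trial d l z z = 1" "trial d l z z' = 0"
proof -
  have zz': "z \<noteq> z'" using assms x_neq_y by (metis doubleton_eq_iff insert_absorb2)
  obtain d' where d: "d = Suc d'" using assms(2) by (cases d) auto
  have w: "z = x \<or> z = y" "z' = x \<or> z' = y" using assms(1) by blast+
  show "trial d l z z = 1" "trial d l z z' = 0"
    unfolding trial_def d sum.lessThan_Suc_shift using w zz' by auto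
qed

text \<open>Pair the eigenvector with (K - l) applied to the trial function. Symmetry of K turns the
  pairing into the left side; evaluating the residual vertex by vertex gives the right side. With l
  = \<mu> the left side disappears, and with l another eigenvalue it contains the gap.\<close>

lemma trial_identity:
  assumes eig: "eigenpair Q \<psi> \<mu>" and z: "{z, z'} = {x, y}" and l: "l \<noteq> 0" and d: "0 < d"
  shows "(\<mu> - l) * (\<Sum>v\<in>UNIV. \<psi> v * trial d l z v)
    = \<psi> z * (Q - l + (\<Sum>k<d. first_hit z k z / l ^ k)) + \<psi> z' * (\<Sum>k<d. first_hit z k z' / l ^ k)
      + (\<Sum>v\<in>-{x,y}. \<psi> v * excursion z d v) / l ^ (d - 1)"
proof -
  let ?f = "trial d l z"
  define R where "R v = (\<Sum>w\<in>UNIV. K Q v w * ?f w) - l * ?f v" for v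
  have zz': "z \<noteq> z'" using z x_neq_y by (metis doubleton_eq_iff insert_absorb2)
  have Af: "(\<Sum>w\<in>UNIV. A v w * ?f w) = (\<Sum>k<d. first_hit z k v / l ^ k)" for v
  proof -
    have "(\<Sum>w\<in>UNIV. A v w * ?f w) = (\<Sum>w\<in>UNIV. \<Sum>k<d. A v w * excursion z k w / l ^ k)"
      by (simp add: trial_def sum_distrib_left)
    also have "\<dots> = (\<Sum>k<d. \<Sum>w\<in>UNIV. A v w * excursion z k w / l ^ k)" by (rule sum.swap)
    finally show ?thesis by (simp add: first_hit_def sum_divide_distrib)
  qed
  have R_off: "R v = excursion z d v / l ^ (d - 1)" if v: "v \<noteq> x" "v \<noteq> y" for v
  proof -
    have vz: "v \<noteq> z" using v z by blast
    \<comment> \<open>The series telescopes: one step of A shifts the excursion length by one, so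
      after subtracting l times the trial function only the term of length \<open>d\<close>
      remains.\<close>
    have "(\<Sum>k<d. first_hit z k v / l ^ k) = (\<Sum>k<d. l * (excursion z (Suc k) v / l ^ Suc k))"
      using v l by (intro sum.cong) (simp_all add: excursion_Suc del: excursion.simps(2))
    also have "\<dots> = l * (excursion z 0 v / l ^ 0 + (\<Sum>k<d. excursion z (Suc k) v / l ^ Suc k))"
      using vz by (simp add: sum_distrib_left)
    also have "\<dots> = l * (\<Sum>k<Suc d. excursion z k v / l ^ k)"
      by (simp only: sum.lessThan_Suc_shift)
    also have "\<dots> = l * ?f v + excursion z d v / l ^ (d - 1)"
      using l d by (simp add: trial_def distrib_left power_eq_if del: excursion.simps)
    finally show ?thesis using v by (simp add: R_def K_apply Af)
  qed
  have w: "z = x \<or> z = y" "z' = x \<or> z' = y" using z by blast+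
  have Rz: "R z = Q - l + (\<Sum>k<d. first_hit z k z / l ^ k)"
    using w trial_wells[OF z d] by (auto simp: R_def K_apply Af)
  have Rz': "R z' = (\<Sum>k<d. first_hit z k z' / l ^ k)"
    using w trial_wells[OF z d] by (auto simp: R_def K_apply Af)
  \<comment> \<open>Moves K from the eigenvector to the trial function by symmetry.\<close>
  have "\<mu> * (\<Sum>v\<in>UNIV. \<psi> v * ?f v) = (\<Sum>v\<in>UNIV. \<Sum>w\<in>UNIV. K Q v w * \<psi> w * ?f v)"
    using eig by (simp add: eigenpair_def sum_distrib_left flip: sum_distrib_right) (simp add: mult_ac)
  also have "\<dots> = (\<Sum>w\<in>UNIV. \<Sum>v\<in>UNIV. K Q v w * \<psi> w * ?f v)" by (rule sum.swap)
  also have "\<dots> = (\<Sum>w\<in>UNIV. \<psi> w * (\<Sum>v\<in>UNIV. K Q w v * ?f v))"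
    by (intro sum.cong refl) (simp add: sum_distrib_left K_sym mult_ac)
  also have "\<dots> = (\<Sum>w\<in>UNIV. \<psi> w * (l * ?f w + R w))" by (simp add: R_def)
  also have "\<dots> = l * (\<Sum>v\<in>UNIV. \<psi> v * ?f v) + (\<Sum>v\<in>UNIV. \<psi> v * R v)"
    by (simp add: distrib_left sum.distrib sum_distrib_left mult_ac)
  finally have "(\<mu> - l) * (\<Sum>v\<in>UNIV. \<psi> v * ?f v) = (\<Sum>v\<in>UNIV. \<psi> v * R v)"
    by (simp add: algebra_simps)
  also have "\<dots> = \<psi> x * R x + \<psi> y * R y + (\<Sum>v\<in>-{x,y}. \<psi> v * R v)"
    by (rule sum_split_wells)
  also have "\<psi> x * R x + \<psi> y * R y = \<psi> z * R z + \<psi> z' * R z'"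
    using w zz' by auto
  also have "(\<Sum>v\<in>-{x,y}. \<psi> v * R v) = (\<Sum>v\<in>-{x,y}. \<psi> v * excursion z d v) / l ^ (d - 1)"
    unfolding sum_divide_distrib by (rule sum.cong) (auto simp: R_off)
  finally show ?thesis by (simp add: Rz Rz')
qed

lemma eigenpair_excursion_bound:
  assumes "eigenpair Q \<psi> \<mu>" "0 < Q" "Q / 2 < \<mu>"
  shows "\<bar>\<Sum>v\<in>-{x,y}. \<psi> v * excursion z d v\<bar> \<le> 2 * real CARD('a) ^ (d + 2) / Q"
  using eigenpair_off_sum_bound[OF assms, of "excursion z d" "real CARD('a) ^ d"]
  by (simp add: excursion_le excursion_nonneg power_add power2_eq_square mult_ac)

lemma eigenpair_trial_bound:
  assumes "eigenpair Q \<psi> \<mu>" "0 < Q" "Q / 2 < \<mu>" "1 \<le> l"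
  shows "\<bar>\<Sum>v\<in>-{x,y}. \<psi> v * trial d l z v\<bar> \<le> 2 * d * real CARD('a) ^ (d + 2) / Q"
proof -
  have "\<bar>trial d l z v\<bar> \<le> d * real CARD('a) ^ d" for v
  proof -
    have "\<bar>trial d l z v\<bar> \<le> (\<Sum>k<d. \<bar>excursion z k v / l ^ k\<bar>)"
      unfolding trial_def by (rule sum_abs)
    also have "\<dots> \<le> (\<Sum>k<d. real CARD('a) ^ d)"
    proof (intro sum_mono)
      fix k assume "k \<in> {..<d}"
      then have "real CARD('a) ^ k \<le> real CARD('a) ^ d" by (intro power_increasing CARD_ge_1) auto
      then have *: "excursion z k v \<le> real CARD('a) ^ d" using excursion_le[of z k v] by linarith
      have "excursion z k v / l ^ k \<le> excursion z k v / 1"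
        using assms(4) by (intro divide_left_mono excursion_nonneg) (auto simp: one_le_power)
      then show "\<bar>excursion z k v / l ^ k\<bar> \<le> real CARD('a) ^ d"
        using * assms(4) excursion_nonneg[of z k v] by simp
    qed
    finally show ?thesis by simp
  qed
  from eigenpair_off_sum_bound[OF assms(1-3) this] show ?thesis
    by (simp add: power_add power2_eq_square mult_ac)
qed

end

section \<open>Secular, mixing and gap equations for wells at distance d\<close>

locale double_well_distance = double_well A x y
  for A :: "'a::finite \<Rightarrow> 'a \<Rightarrow> real" and x y +
  fixes d :: nat
  assumes d_pos: "0 < d"
    and unreachable: "k < d \<Longrightarrow> mat_pow A k y x = 0"
    and mat_pow_sym: "mat_pow A k x y = mat_pow A k y x"
    and reachable: "mat_pow A d y x > 0"
begin

abbreviation \<beta> :: real where "\<beta> \<equiv> mat_pow A d y x"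

abbreviation \<alpha> :: "nat \<Rightarrow> real" where "\<alpha> k \<equiv> first_hit x k x - first_hit y k y"

text \<open>A single generous constant that dominates all the error terms below;
  \<open>C_bounds\<close> lists the comparisons.\<close>

definition C :: real where "C = 4 * (real d + 1) * real CARD('a) ^ (d + 4)"

text \<open>First hits of the other well have zero weight before length \<open>d\<close>, so only
  the last summand survives.\<close>

lemma hit_sum:
  assumes z: "{z, z'} = {x, y}"
  shows "(\<Sum>k<d. first_hit z k z' / l ^ k) = \<beta> / l ^ (d - 1)"
proof -
  have cases: "z = x \<and> z' = y \<or> z = y \<and> z' = x"
    using z by (auto simp: doubleton_eq_iff)
  have un: "mat_pow A k z' z = 0" if "k < d" for k
    using cases unreachable[OF that] mat_pow_sym by auto
  have fh: "first_hit z k z' = mat_pow A (Suc k) z' z" if "k < d" for k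
    by (rule first_hit_other_well[OF z un that])
  obtain d' where d': "d = Suc d'" using d_pos by (cases d) auto
  have "(\<Sum>k<d'. first_hit z k z' / l ^ k) = 0"
    by (intro sum.neutral) (simp add: fh un d' del: mat_pow.simps)
  moreover have "first_hit z d' z' = \<beta>"
    using fh[of d'] cases mat_pow_sym d' by (auto simp del: mat_pow.simps)
  ultimately show ?thesis by (simp add: d')
qed

lemma C_bounds: "2 * real CARD('a) ^ (d + 2) \<le> C / 2" "2 * d * real CARD('a) ^ (d + 2) \<le> C" "8 * real CARD('a) ^ 3 \<le> 2 * C" "0 < C" "2 * real CARD('a) \<le> C"
proof -
  have le: "real CARD('a) ^ k \<le> real CARD('a) ^ (d + 4)" if "k \<le> d + 4" for k by (rule power_increasing[OF that CARD_ge_1])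
  have pos: "0 < real CARD('a) ^ (d + 4)" using CARD_ge_1 by simp
  have "0 \<le> d * real CARD('a) ^ (d + 4)" by simp
  then have C: "C \<ge> 4 * real CARD('a) ^ (d + 4)" by (simp add: C_def algebra_simps)
  show "2 * real CARD('a) ^ (d + 2) \<le> C / 2" using le[of "d + 2"] C by simp
  show "8 * real CARD('a) ^ 3 \<le> 2 * C" using le[of 3] C by simp
  show "0 < C" using pos C by linarith
  show "2 * real CARD('a) \<le> C" using le[of 1] C pos unfolding power_one_right by linarith
  have "2 * d * real CARD('a) ^ (d + 2) \<le> 4 * (real d + 1) * real CARD('a) ^ (d + 4)"
    by (intro mult_mono le) auto
  then show "2 * d * real CARD('a) ^ (d + 2) \<le> C" by (simp add: C_def)
qed

text \<open>\<open>trial_identity\<close> at l = \<mu>, multiplied by \<mu>^(d-1); \<open>r\<close>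
  is the negated contribution of the vertices off the wells.\<close>

lemma secular_equation:
  assumes eig: "eigenpair Q \<psi> \<mu>" "0 < Q" "Q / 2 < \<mu>" and z: "{z, z'} = {x, y}"
  obtains r where "\<bar>r\<bar> \<le> C / (2 * Q)"
    "\<psi> z * (Q - \<mu> + (\<Sum>k<d. first_hit z k z / \<mu> ^ k)) * \<mu> ^ (d - 1) = r - \<psi> z' * \<beta>"
proof
  let ?r = "\<Sum>v\<in>-{x,y}. \<psi> v * excursion z d v"
  have \<mu>: "0 < \<mu>" using eig by simp
  have "2 * real CARD('a) ^ (d + 2) / Q \<le> C / 2 / Q"
    using eig C_bounds(1) by (intro divide_right_mono) auto
  then show "\<bar>- ?r\<bar> \<le> C / (2 * Q)"
    using eigenpair_excursion_bound[OF eig, of z d] by simp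
  have "0 = \<psi> z * (Q - \<mu> + (\<Sum>k<d. first_hit z k z / \<mu> ^ k)) + \<psi> z' * (\<beta> / \<mu> ^ (d - 1)) + ?r / \<mu> ^ (d - 1)"
    using trial_identity[OF eig(1) z _ d_pos, of \<mu>] \<mu> by (simp add: hit_sum[OF z])
  then have "\<psi> z * (Q - \<mu> + (\<Sum>k<d. first_hit z k z / \<mu> ^ k)) = (- ?r - \<psi> z' * \<beta>) / \<mu> ^ (d - 1)"
    by (simp add: diff_divide_distrib add_divide_distrib)
  then show "\<psi> z * (Q - \<mu> + (\<Sum>k<d. first_hit z k z / \<mu> ^ k)) * \<mu> ^ (d - 1) = - ?r - \<psi> z' * \<beta>"
    using \<mu> by simp
qed

text \<open>Multiply the secular equation at \<open>x\<close> by \<psi> y, the one at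
  \<open>y\<close> by \<psi> x, and subtract. The unknown Q - \<mu> cancels and only the difference
  of the return weights is left.\<close>

lemma mixing_equation:
  assumes eig: "eigenpair Q \<psi> \<mu>" "0 < Q" "Q / 2 < \<mu>"
  shows "\<bar>\<psi> x * \<psi> y * (\<Sum>k<d. \<alpha> k * \<mu> ^ (d - 1 - k)) + \<beta> * ((\<psi> y)\<^sup>2 - (\<psi> x)\<^sup>2)\<bar> \<le> C / Q"
proof -
  have \<mu>: "0 < \<mu>" using eig by simp
  obtain r where r: "\<bar>r\<bar> \<le> C / (2 * Q)"
    "\<psi> x * (Q - \<mu> + (\<Sum>k<d. first_hit x k x / \<mu> ^ k)) * \<mu> ^ (d - 1) = r - \<psi> y * \<beta>"
    by (rule secular_equation[OF eig refl])
  obtain r' where r': "\<bar>r'\<bar> \<le> C / (2 * Q)"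
    "\<psi> y * (Q - \<mu> + (\<Sum>k<d. first_hit y k y / \<mu> ^ k)) * \<mu> ^ (d - 1) = r' - \<psi> x * \<beta>"
    by (rule secular_equation[OF eig insert_commute])
  have *: "(\<Sum>k<d. first_hit z k z / \<mu> ^ k) * \<mu> ^ (d - 1) = (\<Sum>k<d. first_hit z k z * \<mu> ^ (d - 1 - k))" for z
    unfolding sum_distrib_right using \<mu> by (intro sum.cong) (auto simp: power_diff)
  have a: "(\<Sum>k<d. \<alpha> k * \<mu> ^ (d - 1 - k)) = ((\<Sum>k<d. first_hit x k x / \<mu> ^ k) - (\<Sum>k<d. first_hit y k y / \<mu> ^ k)) * \<mu> ^ (d - 1)"
    by (simp only: left_diff_distrib *) (simp add: sum_subtractf)
  have "\<psi> x * \<psi> y * (\<Sum>k<d. \<alpha> k * \<mu> ^ (d - 1 - k)) + \<beta> * ((\<psi> y)\<^sup>2 - (\<psi> x)\<^sup>2)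
     = \<psi> y * (\<psi> x * (Q - \<mu> + (\<Sum>k<d. first_hit x k x / \<mu> ^ k)) * \<mu> ^ (d - 1) + \<psi> y * \<beta>)
      - \<psi> x * (\<psi> y * (Q - \<mu> + (\<Sum>k<d. first_hit y k y / \<mu> ^ k)) * \<mu> ^ (d - 1) + \<psi> x * \<beta>)"
    unfolding a by (simp add: algebra_simps power2_eq_square)
  also have "\<dots> = \<psi> y * r - \<psi> x * r'" unfolding r r' by simp
  finally have eq: "\<psi> x * \<psi> y * (\<Sum>k<d. \<alpha> k * \<mu> ^ (d - 1 - k)) + \<beta> * ((\<psi> y)\<^sup>2 - (\<psi> x)\<^sup>2) = \<psi> y * r - \<psi> x * r'" .
  have "\<bar>\<psi> y * r\<bar> \<le> C / (2 * Q)" "\<bar>\<psi> x * r'\<bar> \<le> C / (2 * Q)"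
    by (intro eigenpair_mult_le[OF eig(1)] r(1) r'(1))+
  then show ?thesis unfolding eq by (simp add: abs_le_iff)
qed

text \<open>Pair the second eigenvector with the trial function at the energy of the first.
  Multiplying by \<open>\<psi>1 x\<close> allows the secular equation of the first eigenvector to
  eliminate the diagonal term, and the determinant of the well entries appears; \<eta> is the
  off-well part of the pairing.\<close>

lemma gap_equation:
  assumes eig1: "eigenpair Q \<psi>1 \<mu>1" "2 \<le> Q" "Q / 2 < \<mu>1"
    and eig2: "eigenpair Q \<psi>2 \<mu>2" "Q / 2 < \<mu>2"
  obtains \<eta> r where "\<bar>\<eta>\<bar> \<le> C / Q" "\<bar>r\<bar> \<le> C / Q"
    "\<psi>1 x * (\<mu>2 - \<mu>1) * (\<psi>2 x + \<eta>) * \<mu>1 ^ (d - 1) = \<beta> * (\<psi>2 y * \<psi>1 x - \<psi>2 x * \<psi>1 y) + r"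
proof -
  have Q: "0 < Q" and \<mu>1: "1 \<le> \<mu>1" using eig1 by auto
  let ?a = "Q - \<mu>1 + (\<Sum>k<d. first_hit x k x / \<mu>1 ^ k)"
  obtain r where r: "\<bar>r\<bar> \<le> C / (2 * Q)" "\<psi>1 x * ?a * \<mu>1 ^ (d - 1) = r - \<psi>1 y * \<beta>"
    by (rule secular_equation[OF eig1(1) Q eig1(3) refl])
  define \<eta> where "\<eta> = (\<Sum>v\<in>-{x,y}. \<psi>2 v * trial d \<mu>1 x v)"
  define e where "e = (\<Sum>v\<in>-{x,y}. \<psi>2 v * excursion x d v)"
  have "2 * real CARD('a) ^ (d + 2) / Q \<le> C / 2 / Q" "2 * d * real CARD('a) ^ (d + 2) / Q \<le> C / Q"
    using Q by (intro divide_right_mono C_bounds; simp)+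
  then have bounds: "\<bar>\<eta>\<bar> \<le> C / Q" "\<bar>e\<bar> \<le> C / (2 * Q)"
    using eigenpair_trial_bound[OF eig2(1) Q eig2(2) \<mu>1, of d x]
      eigenpair_excursion_bound[OF eig2(1) Q eig2(2), of x d]
    by (auto simp: \<eta>_def e_def)
  have "(\<Sum>v\<in>UNIV. \<psi>2 v * trial d \<mu>1 x v) = \<psi>2 x + \<eta>"
    unfolding sum_split_wells \<eta>_def using trial_wells[OF refl d_pos] by simp
  then have "(\<mu>2 - \<mu>1) * (\<psi>2 x + \<eta>) = \<psi>2 x * ?a + \<psi>2 y * (\<beta> / \<mu>1 ^ (d - 1)) + e / \<mu>1 ^ (d - 1)"
    using trial_identity[OF eig2(1) refl _ d_pos, of \<mu>1] \<mu>1 by (simp add: hit_sum e_def)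
  then have "(\<mu>2 - \<mu>1) * (\<psi>2 x + \<eta>) * \<mu>1 ^ (d - 1) = \<psi>2 x * ?a * \<mu>1 ^ (d - 1) + \<psi>2 y * \<beta> + e"
    using \<mu>1 by (simp add: distrib_right)
  then have "\<psi>1 x * ((\<mu>2 - \<mu>1) * (\<psi>2 x + \<eta>) * \<mu>1 ^ (d - 1))
      = \<psi>1 x * (\<psi>2 x * ?a * \<mu>1 ^ (d - 1) + \<psi>2 y * \<beta> + e)" by simp
  also have "\<dots> = \<psi>2 x * (\<psi>1 x * ?a * \<mu>1 ^ (d - 1)) + \<psi>1 x * \<psi>2 y * \<beta> + \<psi>1 x * e"
    by (simp add: algebra_simps)
  also have "\<dots> = \<beta> * (\<psi>2 y * \<psi>1 x - \<psi>2 x * \<psi>1 y) + (\<psi>2 x * r + \<psi>1 x * e)"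
    unfolding r by (simp add: algebra_simps)
  finally have eq: "\<psi>1 x * (\<mu>2 - \<mu>1) * (\<psi>2 x + \<eta>) * \<mu>1 ^ (d - 1) = \<beta> * (\<psi>2 y * \<psi>1 x - \<psi>2 x * \<psi>1 y) + (\<psi>2 x * r + \<psi>1 x * e)"
    by (simp add: mult_ac)
  have "\<bar>\<psi>2 x * r\<bar> \<le> C / (2 * Q)" "\<bar>\<psi>1 x * e\<bar> \<le> C / (2 * Q)"
    using r(1) bounds(2) by (auto intro: eigenpair_mult_le[OF eig1(1)] eigenpair_mult_le[OF eig2(1)])
  then have "\<bar>\<psi>2 x * r + \<psi>1 x * e\<bar> \<le> C / Q" by (simp add: abs_le_iff)
  with bounds(1) eq show thesis using that by blast
qed

end

section \<open>The two high eigenvalues\<close>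

context double_well
begin

context
  fixes Q :: real and \<psi> :: "'a \<Rightarrow> 'a \<Rightarrow> real" and \<mu> :: "'a \<Rightarrow> real"
  assumes Q_large: "4 * real CARD('a) ^ 2 \<le> Q"
    and eig: "\<And>j v. (\<Sum>w\<in>UNIV. K Q v w * \<psi> j w) = \<mu> j * \<psi> j v"
    and orth: "\<And>i j. (\<Sum>v\<in>UNIV. \<psi> i v * \<psi> j v) = (if i = j then 1 else 0)"
    and compl: "\<And>v w. (\<Sum>j\<in>UNIV. \<psi> j v * \<psi> j w) = (if v = w then 1 else 0)"
begin

lemma eigenbasis_eigenpair: "eigenpair Q (\<psi> j) (\<mu> j)"
  using eig orth[of j j] by (simp add: eigenpair_def power2_eq_square)

text \<open>The threshold on \<open>Q\<close> makes the mass error 4 N^3 / Q^2, with N the number of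
  vertices, smaller than 1/3; this is what the eigenvalue count needs.\<close>

lemma Q_bounds: "4 \<le> Q" "12 * real CARD('a) ^ 3 / Q\<^sup>2 < 1"
proof -
  have N: "1 \<le> real CARD('a)" by (rule CARD_ge_1)
  have "1 \<le> real CARD('a) ^ 2" using N by (rule one_le_power)
  then show "4 \<le> Q" using Q_large by linarith
  have "12 * real CARD('a) ^ 3 \<le> 12 * real CARD('a) ^ 4"
    using N by (intro mult_left_mono power_increasing) auto
  also have "\<dots> < (4 * real CARD('a) ^ 2)\<^sup>2" by (simp add: power_mult_distrib flip: power_mult)
  also have "\<dots> \<le> Q\<^sup>2" using Q_large by (intro power_mono) auto
  finally show "12 * real CARD('a) ^ 3 / Q\<^sup>2 < 1" using \<open>4 \<le> Q\<close> by (simp add: divide_simps)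
qed

lemma div_Q_square_le: "0 \<le> c \<Longrightarrow> c / Q\<^sup>2 \<le> c / Q"
  using Q_bounds(1) by (intro divide_left_mono) (auto simp: power2_eq_square)

lemma well_mass_high:
  assumes "Q / 2 < \<mu> j"
  shows "1 - 4 * real CARD('a) ^ 3 / Q\<^sup>2 \<le> (\<psi> j x)\<^sup>2 + (\<psi> j y)\<^sup>2" "(\<psi> j x)\<^sup>2 + (\<psi> j y)\<^sup>2 \<le> 1"
proof -
  have Q: "0 < Q" using Q_bounds by simp
  have "(\<psi> j x)\<^sup>2 + (\<psi> j y)\<^sup>2 + (\<Sum>v\<in>-{x,y}. (\<psi> j v)\<^sup>2) = 1"
    using orth[of j j] sum_split_wells[of "\<lambda>v. (\<psi> j v)\<^sup>2"] by (simp add: power2_eq_square)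
  moreover have "0 \<le> (\<Sum>v\<in>-{x,y}. (\<psi> j v)\<^sup>2)" by (rule sum_nonneg) simp
  moreover have "(\<Sum>v\<in>-{x,y}. (\<psi> j v)\<^sup>2) \<le> 4 * real CARD('a) ^ 3 / Q\<^sup>2"
  proof -
    have "(\<Sum>v\<in>-{x,y}. (\<psi> j v)\<^sup>2) \<le> (\<Sum>v\<in>-{x,y}. (2 * real CARD('a) / Q)\<^sup>2)"
    proof (rule sum_mono)
      fix v assume "v \<in> -{x,y}"
      then have "\<bar>\<psi> j v\<bar> \<le> 2 * real CARD('a) / Q"
        using eigenpair_off_wells[OF eigenbasis_eigenpair _ _ Q assms] by simp
      then have "\<bar>\<psi> j v\<bar>\<^sup>2 \<le> (2 * real CARD('a) / Q)\<^sup>2" by (intro power_mono) auto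
      then show "(\<psi> j v)\<^sup>2 \<le> (2 * real CARD('a) / Q)\<^sup>2" by simp
    qed
    also have "\<dots> \<le> (\<Sum>v\<in>(UNIV::'a set). (2 * real CARD('a) / Q)\<^sup>2)" by (intro sum_mono2) auto
    also have "\<dots> = 4 * real CARD('a) ^ 3 / Q\<^sup>2"
      by (simp add: power_divide power_mult_distrib power2_eq_square power3_eq_cube)
    finally show ?thesis .
  qed
  ultimately show "1 - 4 * real CARD('a) ^ 3 / Q\<^sup>2 \<le> (\<psi> j x)\<^sup>2 + (\<psi> j y)\<^sup>2" "(\<psi> j x)\<^sup>2 + (\<psi> j y)\<^sup>2 \<le> 1"
    by linarith+
qed

lemma low_wells_product:
  assumes "\<not> Q / 2 < \<mu> j" "v = x \<or> v = y" "w = x \<or> w = y"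
  shows "\<bar>\<psi> j v\<bar> * \<bar>\<psi> j w\<bar> \<le> 4 * real CARD('a) ^ 2 / Q\<^sup>2"
proof -
  have Q: "0 < Q" using Q_bounds by simp
  have "\<bar>\<psi> j v\<bar> * \<bar>\<psi> j w\<bar> \<le> (2 * real CARD('a) / Q) * (2 * real CARD('a) / Q)"
    using assms by (intro mult_mono eigenpair_low[OF eigenbasis_eigenpair _ Q]) (use Q in auto)
  then show ?thesis by (simp add: power2_eq_square)
qed

lemma low_sum_le:
  assumes "v = x \<or> v = y" "w = x \<or> w = y"
  shows "(\<Sum>j | \<not> Q / 2 < \<mu> j. \<bar>\<psi> j v\<bar> * \<bar>\<psi> j w\<bar>) \<le> 4 * real CARD('a) ^ 3 / Q\<^sup>2"
proof -
  have "(\<Sum>j | \<not> Q / 2 < \<mu> j. \<bar>\<psi> j v\<bar> * \<bar>\<psi> j w\<bar>) \<le> (\<Sum>j | \<not> Q / 2 < \<mu> j. 4 * real CARD('a) ^ 2 / Q\<^sup>2)"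
    using assms by (intro sum_mono low_wells_product) auto
  also have "\<dots> \<le> (\<Sum>j\<in>(UNIV::'a set). 4 * real CARD('a) ^ 2 / Q\<^sup>2)" by (intro sum_mono2) auto
  also have "\<dots> = 4 * real CARD('a) ^ 3 / Q\<^sup>2" by (simp add: power2_eq_square power3_eq_cube)
  finally show ?thesis .
qed

text \<open>The two wells carry total mass 2 over the eigenbasis; each high eigenvector takes almost
  mass 1 of it and the low ones take almost nothing.\<close>

lemma card_high_eigenvalues: "card {j. Q / 2 < \<mu> j} = 2"
proof -
  let ?J = "{j. Q / 2 < \<mu> j}"
  let ?e = "4 * real CARD('a) ^ 3 / Q\<^sup>2"
  define m where "m j = (\<psi> j x)\<^sup>2 + (\<psi> j y)\<^sup>2" for j
  have e: "?e < 1/3" using Q_bounds(2) by simp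
  have "(\<Sum>j\<in>UNIV. m j) = 2"
    using compl[of x x] compl[of y y] by (simp add: m_def sum.distrib power2_eq_square)
  moreover have "(\<Sum>j\<in>UNIV. m j) = (\<Sum>j\<in>?J. m j) + (\<Sum>j | \<not> Q / 2 < \<mu> j. m j)"
    using sum.union_disjoint[of ?J "{j. \<not> Q / 2 < \<mu> j}" m] by (simp add: Collect_disj_eq[symmetric] disjoint_iff)
  moreover have "(\<Sum>j | \<not> Q / 2 < \<mu> j. m j) \<le> 2 * ?e"
    using low_sum_le[of x x] low_sum_le[of y y] by (simp add: m_def sum.distrib power2_eq_square)
  moreover have "0 \<le> (\<Sum>j | \<not> Q / 2 < \<mu> j. m j)" by (rule sum_nonneg) (simp add: m_def)
  ultimately have sum: "2 - 2 * ?e \<le> (\<Sum>j\<in>?J. m j)" "(\<Sum>j\<in>?J. m j) \<le> 2" by linarith+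
  have "(\<Sum>j\<in>?J. m j) \<le> (\<Sum>j\<in>?J. 1)" by (rule sum_mono) (simp add: m_def well_mass_high)
  then have "2 - 2 * ?e \<le> card ?J" using sum by simp
  \<comment> \<open>With error below 1/3 the lower count is 2 - 2/3 > 1. Conversely, each high
    eigenvector has mass above 2/3 and the total is at most 2, so there are fewer than
    three.\<close>
  then have "1 < real (card ?J)" using e by linarith
  moreover have "real (card ?J) < 3"
  proof -
    have "(\<Sum>j\<in>?J. 1 - ?e) \<le> (\<Sum>j\<in>?J. m j)" by (rule sum_mono) (simp add: m_def well_mass_high)
    then have "real (card ?J) * (1 - ?e) \<le> 2" using sum by simp
    moreover have "real (card ?J) * (2/3) < real (card ?J) * (1 - ?e)"
      using e \<open>1 < real (card ?J)\<close> by (intro mult_strict_left_mono) auto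
    ultimately show ?thesis by linarith
  qed
  ultimately show ?thesis by linarith
qed

text \<open>By completeness the products \<psi> k x * \<psi> k y sum to 0 and the low ones are
  negligible, so the two high products are nearly opposite. The state is then one product times the
  difference of two phases. Near-orthogonality on the wells is full orthogonality minus the small
  rest.\<close>

lemma two_level_reduction:
  obtains i j where "i \<noteq> j" "Q / 2 < \<mu> i" "Q / 2 < \<mu> j"
    "\<bar>\<psi> i x * \<psi> i y + \<psi> j x * \<psi> j y\<bar> \<le> 4 * real CARD('a) ^ 3 / Q"
    "\<bar>\<psi> i x * \<psi> j x + \<psi> i y * \<psi> j y\<bar> \<le> 4 * real CARD('a) ^ 3 / Q"
    "\<And>t. \<bar>cmod (\<Sum>k\<in>UNIV. cis (t * (1 - \<mu> k)) * complex_of_real (\<psi> k y * \<psi> k x))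
        - \<bar>\<psi> i x * \<psi> i y\<bar> * cmod (cis (t * (\<mu> j - \<mu> i)) - 1)\<bar> \<le> 8 * real CARD('a) ^ 3 / Q"
proof -
  obtain i j where ij: "i \<noteq> j" "{k. Q / 2 < \<mu> k} = {i, j}"
    using card_high_eigenvalues by (auto simp: card_2_iff)
  let ?N = "real CARD('a)"
  let ?L = "{k. \<not> Q / 2 < \<mu> k}"
  have Q: "0 < Q" using Q_bounds by simp
  have high: "Q / 2 < \<mu> i" "Q / 2 < \<mu> j" using ij by blast+
  have split: "(\<Sum>k\<in>UNIV. g k) = g i + g j + (\<Sum>k\<in>?L. g k)" for g :: "'a \<Rightarrow> complex"
  proof -
    have "(\<Sum>k\<in>UNIV. g k) = (\<Sum>k\<in>{i,j}. g k) + (\<Sum>k\<in>?L. g k)"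
      unfolding ij(2)[symmetric]
      using sum.union_disjoint[of "{k. Q / 2 < \<mu> k}" ?L g] by (simp add: Collect_disj_eq[symmetric] disjoint_iff)
    then show ?thesis using ij(1) by simp
  qed
  have le: "4 * ?N ^ 3 / Q\<^sup>2 \<le> 4 * ?N ^ 3 / Q" by (rule div_Q_square_le) simp
  have low: "cmod (\<Sum>k\<in>?L. c k * complex_of_real (\<psi> k y * \<psi> k x)) \<le> 4 * ?N ^ 3 / Q"
    if "\<And>k. cmod (c k) = 1" for c
  proof -
    have "cmod (\<Sum>k\<in>?L. c k * complex_of_real (\<psi> k y * \<psi> k x)) \<le> (\<Sum>k\<in>?L. \<bar>\<psi> k y\<bar> * \<bar>\<psi> k x\<bar>)"
      by (rule sum_norm_le) (simp add: norm_mult that)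
    also have "\<dots> \<le> 4 * ?N ^ 3 / Q\<^sup>2" by (rule low_sum_le) auto
    finally show ?thesis using le by linarith
  qed
  define pi' where "pi' = complex_of_real (\<psi> i y * \<psi> i x)"
  define pj where "pj = complex_of_real (\<psi> j y * \<psi> j x)"
  have "(\<Sum>k\<in>UNIV. complex_of_real (\<psi> k y * \<psi> k x)) = 0"
    using compl[of y x] x_neq_y by (simp flip: of_real_sum of_real_mult)
  then have "pi' + pj = - (\<Sum>k\<in>?L. 1 * complex_of_real (\<psi> k y * \<psi> k x))"
    unfolding split pi'_def pj_def by (simp add: eq_neg_iff_add_eq_0)
  then have s0: "cmod (pi' + pj) \<le> 4 * ?N ^ 3 / Q"
    using low[of "\<lambda>_. 1"] by (simp only: norm_minus_cancel norm_one)
  show thesis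
  proof
    have "cmod (pi' + pj) = \<bar>\<psi> i x * \<psi> i y + \<psi> j x * \<psi> j y\<bar>"
      unfolding pi'_def pj_def of_real_add[symmetric] norm_of_real by (simp add: mult.commute)
    then show "\<bar>\<psi> i x * \<psi> i y + \<psi> j x * \<psi> j y\<bar> \<le> 4 * ?N ^ 3 / Q"
      using s0 by simp
    have "\<psi> i x * \<psi> j x + \<psi> i y * \<psi> j y = - (\<Sum>v\<in>-{x,y}. \<psi> i v * \<psi> j v)"
      using orth[of i j] ij(1) sum_split_wells[of "\<lambda>v. \<psi> i v * \<psi> j v"] by simp
    moreover have "\<bar>\<Sum>v\<in>-{x,y}. \<psi> i v * \<psi> j v\<bar> \<le> 2 * ?N\<^sup>2 * 1 / Q"
      by (rule eigenpair_off_sum_bound[OF eigenbasis_eigenpair Q high(1)])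
         (rule eigenpair_abs_le_1[OF eigenbasis_eigenpair])
    moreover have "2 * ?N\<^sup>2 * 1 / Q \<le> 4 * ?N ^ 3 / Q"
    proof (rule divide_right_mono)
      have "?N ^ 2 \<le> ?N ^ 3" by (rule power_increasing[OF _ CARD_ge_1]) simp
      moreover have "0 \<le> ?N ^ 3" by simp
      ultimately show "2 * ?N\<^sup>2 * 1 \<le> 4 * ?N ^ 3" by linarith
    qed (use Q in simp)
    ultimately show "\<bar>\<psi> i x * \<psi> j x + \<psi> i y * \<psi> j y\<bar> \<le> 4 * ?N ^ 3 / Q" by linarith
  next
    fix t :: real
    let ?S = "\<Sum>k\<in>UNIV. cis (t * (1 - \<mu> k)) * complex_of_real (\<psi> k y * \<psi> k x)"
    let ?ci = "cis (t * (1 - \<mu> i))" and ?cj = "cis (t * (1 - \<mu> j))"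
    let ?R = "\<Sum>k\<in>?L. cis (t * (1 - \<mu> k)) * complex_of_real (\<psi> k y * \<psi> k x)"
    \<comment> \<open>A common phase is factored out; it does not affect the modulus.\<close>
    have "?ci = ?cj * cis (t * (\<mu> j - \<mu> i))" by (simp add: cis_mult algebra_simps)
    then have "?S = ?cj * (cis (t * (\<mu> j - \<mu> i)) - 1) * pi' + (?cj * (pi' + pj) + ?R)"
      unfolding split pi'_def pj_def by (simp add: algebra_simps)
    then have "?S - ?cj * (cis (t * (\<mu> j - \<mu> i)) - 1) * pi' = ?cj * (pi' + pj) + ?R" by simp
    then have "cmod (?S - ?cj * (cis (t * (\<mu> j - \<mu> i)) - 1) * pi') \<le> cmod (?cj * (pi' + pj)) + cmod ?R"
      by (simp only: norm_triangle_ineq)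
    also have "\<dots> \<le> 4 * ?N ^ 3 / Q + 4 * ?N ^ 3 / Q"
      using s0 low[of "\<lambda>k. cis (t * (1 - \<mu> k))"] by (intro add_mono) (simp_all add: norm_mult)
    finally have "\<bar>cmod ?S - cmod (?cj * (cis (t * (\<mu> j - \<mu> i)) - 1) * pi')\<bar> \<le> 8 * ?N ^ 3 / Q"
      using norm_triangle_ineq3[of ?S "?cj * (cis (t * (\<mu> j - \<mu> i)) - 1) * pi'"] by simp
    moreover have "cmod (?cj * (cis (t * (\<mu> j - \<mu> i)) - 1) * pi')
        = \<bar>\<psi> i x * \<psi> i y\<bar> * cmod (cis (t * (\<mu> j - \<mu> i)) - 1)"
      unfolding pi'_def norm_mult norm_of_real by (simp add: mult_ac abs_mult)
    ultimately show "\<bar>cmod ?S - \<bar>\<psi> i x * \<psi> i y\<bar> * cmod (cis (t * (\<mu> j - \<mu> i)) - 1)\<bar> \<le> 8 * ?N ^ 3 / Q"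
      by simp
  qed (use ij high in auto)
qed

lemma high_eigenvalue_near_Q:
  assumes "Q / 2 < \<mu> j"
  shows "\<bar>\<mu> j - Q\<bar> \<le> 2 * real CARD('a)"
proof -
  have "1 / 2 < (\<psi> j x)\<^sup>2 + (\<psi> j y)\<^sup>2" using well_mass_high(1)[OF assms] Q_bounds(2) by linarith
  \<comment> \<open>One well carries more than half of this mass, so its entry exceeds 1/2 in
    modulus and \<open>eigenpair_wells\<close> controls \<mu> - Q.\<close>
  then have "1 / 4 < (\<psi> j x)\<^sup>2 \<or> 1 / 4 < (\<psi> j y)\<^sup>2" by linarith
  then obtain v where v: "v = x \<or> v = y" "1 / 4 < (\<psi> j v)\<^sup>2" by blast
  then have "(1 / 2)\<^sup>2 < \<bar>\<psi> j v\<bar>\<^sup>2" by (simp add: power2_eq_square)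
  then have "1 / 2 < \<bar>\<psi> j v\<bar>" by (rule power_less_imp_less_base) simp
  then have "\<bar>\<mu> j - Q\<bar> * (1/2) \<le> \<bar>\<mu> j - Q\<bar> * \<bar>\<psi> j v\<bar>" by (intro mult_left_mono) auto
  from order_trans[OF this eigenpair_wells[OF eigenbasis_eigenpair v(1)]] show ?thesis by simp
qed

end

end

section \<open>Asymptotics of mixing and gap\<close>

lemma tendsto_zero_of_le_const_div:
  fixes f :: "real \<Rightarrow> real"
  assumes "eventually (\<lambda>Q. \<bar>f Q\<bar> \<le> c / Q) at_top"
  shows "(f \<longlongrightarrow> 0) at_top"
proof (rule Lim_null_comparison)
  show "eventually (\<lambda>Q. norm (f Q) \<le> c / Q) at_top" using assms by simp
  show "((\<lambda>Q. c / Q) \<longlongrightarrow> 0) at_top"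
    by (rule real_tendsto_divide_at_top[OF tendsto_const filterlim_ident])
qed

context double_well_distance
begin

text \<open>Bundles everything the asymptotics need about the two high eigenvectors at one
  \<open>Q\<close>, so that families in \<open>Q\<close> can be obtained by a single choice.
  Closeness to \<open>Q\<close> is recorded for \<mu>1 alone, whose powers occur in the gap
  equation.\<close>

definition two_level_pair ::
  "(real \<Rightarrow> real) \<Rightarrow> real \<Rightarrow> ('a \<Rightarrow> real) \<Rightarrow> real \<Rightarrow> ('a \<Rightarrow> real) \<Rightarrow> real \<Rightarrow> bool" where
  "two_level_pair F Q \<psi>1 \<mu>1 \<psi>2 \<mu>2 \<longleftrightarrow>
     eigenpair Q \<psi>1 \<mu>1 \<and> Q / 2 < \<mu>1 \<and> \<bar>\<mu>1 - Q\<bar> \<le> C \<and> \<bar>(\<psi>1 x)\<^sup>2 + (\<psi>1 y)\<^sup>2 - 1\<bar> \<le> C / Q \<and>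
     eigenpair Q \<psi>2 \<mu>2 \<and> Q / 2 < \<mu>2 \<and> \<bar>(\<psi>2 x)\<^sup>2 + (\<psi>2 y)\<^sup>2 - 1\<bar> \<le> C / Q \<and>
     \<bar>\<psi>1 x * \<psi>2 x + \<psi>1 y * \<psi>2 y\<bar> \<le> C / Q \<and>
     (\<forall>t. \<bar>F t - \<bar>\<psi>1 x * \<psi>1 y\<bar> * cmod (cis (t * (\<mu>2 - \<mu>1)) - 1)\<bar> \<le> 2 * C / Q)"

lemma ex_two_level_pair:
  assumes Q: "4 * real CARD('a) ^ 2 \<le> Q"
    and F: "\<And>\<psi> \<mu>. (\<And>j v. (\<Sum>w\<in>UNIV. K Q v w * \<psi> j w) = \<mu> j * \<psi> j v) \<Longrightarrow>
      (\<And>v w. (\<Sum>j\<in>UNIV. \<psi> j v * \<psi> j w) = (if v = w then 1 else 0)) \<Longrightarrow>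
      F = (\<lambda>t. cmod (\<Sum>k\<in>(UNIV::'a set). cis (t * (1 - \<mu> k)) * complex_of_real (\<psi> k y * \<psi> k x)))"
  shows "\<exists>\<psi>1 \<mu>1 \<psi>2 \<mu>2. two_level_pair F Q \<psi>1 \<mu>1 \<psi>2 \<mu>2"
proof -
  obtain \<psi> :: "'a \<Rightarrow> 'a \<Rightarrow> real" and \<mu> :: "'a \<Rightarrow> real" where
    basis: "\<And>j v. (\<Sum>w\<in>UNIV. K Q v w * \<psi> j w) = \<mu> j * \<psi> j v"
      "\<And>i j. (\<Sum>v\<in>UNIV. \<psi> i v * \<psi> j v) = (if i = j then 1 else 0)"
      "\<And>v w. (\<Sum>j\<in>UNIV. \<psi> j v * \<psi> j w) = (if v = w then 1 else 0)"
    using symmetric_matrix_eigenbasis[of "K Q", OF K_sym] by blast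
  note F = F[OF basis(1,3)]
  let ?N = "real CARD('a)"
  obtain i j where ij: "i \<noteq> j" "Q / 2 < \<mu> i" "Q / 2 < \<mu> j"
    "\<bar>\<psi> i x * \<psi> j x + \<psi> i y * \<psi> j y\<bar> \<le> 4 * ?N ^ 3 / Q"
    "\<And>t. \<bar>F t - \<bar>\<psi> i x * \<psi> i y\<bar> * cmod (cis (t * (\<mu> j - \<mu> i)) - 1)\<bar> \<le> 8 * ?N ^ 3 / Q"
    unfolding F by (rule two_level_reduction[OF Q basis]) blast
  have Q0: "0 < Q" using Q_bounds(1)[OF Q basis] by simp
  have N: "4 * ?N ^ 3 / Q \<le> C / Q" "8 * ?N ^ 3 / Q \<le> 2 * C / Q"
    using C_bounds(3) Q0 by (auto intro!: divide_right_mono)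
  have mass: "\<bar>(\<psi> k x)\<^sup>2 + (\<psi> k y)\<^sup>2 - 1\<bar> \<le> C / Q" if "Q / 2 < \<mu> k" for k
  proof -
    have "4 * ?N ^ 3 / Q\<^sup>2 \<le> 4 * ?N ^ 3 / Q" by (rule div_Q_square_le[OF Q basis]) simp
    then show ?thesis using well_mass_high[OF Q basis that] N(1) by linarith
  qed
  have "two_level_pair F Q (\<psi> i) (\<mu> i) (\<psi> j) (\<mu> j)"
    unfolding two_level_pair_def
    using eigenbasis_eigenpair[OF Q basis] ij mass N
      high_eigenvalue_near_Q[OF Q basis ij(2)] C_bounds(5)
    by (meson order_trans)
  then show ?thesis by blast
qed

text \<open>Only the constant term of the \<alpha>-sum survives, so the mixing equation says X
  \<longlongrightarrow> 0. Together with r \<longlongrightarrow> 1 this determines the square of the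
  product of the well entries.\<close>

lemma mixing_limit:
  assumes eig: "eventually (\<lambda>Q. eigenpair Q (\<psi> Q) (\<mu> Q) \<and> Q / 2 < \<mu> Q
      \<and> \<bar>(\<psi> Q x)\<^sup>2 + (\<psi> Q y)\<^sup>2 - 1\<bar> \<le> C / Q) at_top"
    and \<alpha>: "\<And>k. k < d - 1 \<Longrightarrow> \<alpha> k = 0"
  shows "((\<lambda>Q. \<bar>\<psi> Q x * \<psi> Q y\<bar>) \<longlongrightarrow> sqrt (\<beta>\<^sup>2 / ((\<alpha> (d - 1))\<^sup>2 + 4 * \<beta>\<^sup>2))) at_top"
proof -
  define \<delta> where "\<delta> = \<alpha> (d - 1)"
  define X where "X Q = \<psi> Q x * \<psi> Q y * \<delta> + \<beta> * ((\<psi> Q y)\<^sup>2 - (\<psi> Q x)\<^sup>2)" for Q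
  define r where "r Q = (\<psi> Q x)\<^sup>2 + (\<psi> Q y)\<^sup>2" for Q
  have sum: "(\<Sum>k<d. \<alpha> k * m ^ (d - 1 - k)) = \<delta>" for m :: real
  proof -
    obtain d' where d': "d = Suc d'" using d_pos by (cases d) auto
    have "(\<Sum>k<d'. \<alpha> k * m ^ (d - 1 - k)) = 0" using \<alpha> d' by (intro sum.neutral) auto
    then show ?thesis by (simp add: d' \<delta>_def)
  qed
  have X: "(X \<longlongrightarrow> 0) at_top"
  proof (rule tendsto_zero_of_le_const_div)
    show "eventually (\<lambda>Q. \<bar>X Q\<bar> \<le> C / Q) at_top"
      using eig eventually_gt_at_top[of 0]
    proof eventually_elim
      case (elim Q)
      then show ?case using mixing_equation[of Q "\<psi> Q" "\<mu> Q"] unfolding X_def sum by blast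
    qed
  qed
  have "((\<lambda>Q. r Q - 1) \<longlongrightarrow> 0) at_top"
    by (rule tendsto_zero_of_le_const_div[of _ C], rule eventually_mono[OF eig]) (simp add: r_def)
  then have r: "(r \<longlongrightarrow> 1) at_top" by (simp add: LIM_zero_iff)
  have Xu: "((\<lambda>Q. X Q * (\<psi> Q x * \<psi> Q y)) \<longlongrightarrow> 0) at_top"
  proof (rule Lim_null_comparison)
    show "((\<lambda>Q. \<bar>X Q\<bar>) \<longlongrightarrow> 0) at_top" using X by (rule tendsto_rabs_zero)
    show "eventually (\<lambda>Q. norm (X Q * (\<psi> Q x * \<psi> Q y)) \<le> \<bar>X Q\<bar>) at_top"
      using eig
    proof eventually_elim
      case (elim Q)
      then have "\<bar>\<psi> Q x * (\<psi> Q y * X Q)\<bar> \<le> \<bar>X Q\<bar>"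
        by (intro eigenpair_mult_le[of Q "\<psi> Q" "\<mu> Q"]) auto
      then show ?case by (simp add: mult_ac)
    qed
  qed
  have pos: "0 < \<delta>\<^sup>2 + 4 * \<beta>\<^sup>2" using reachable by (intro add_nonneg_pos) auto
  have "((\<lambda>Q. (\<beta>\<^sup>2 * (r Q)\<^sup>2 + 2 * \<delta> * (X Q * (\<psi> Q x * \<psi> Q y)) - (X Q)\<^sup>2) / (\<delta>\<^sup>2 + 4 * \<beta>\<^sup>2))
      \<longlongrightarrow> (\<beta>\<^sup>2 * 1\<^sup>2 + 2 * \<delta> * 0 - 0\<^sup>2) / (\<delta>\<^sup>2 + 4 * \<beta>\<^sup>2)) at_top"
    using pos by (intro tendsto_intros X r Xu) auto
  moreover have "(\<beta>\<^sup>2 * (r Q)\<^sup>2 + 2 * \<delta> * (X Q * (\<psi> Q x * \<psi> Q y)) - (X Q)\<^sup>2) / (\<delta>\<^sup>2 + 4 * \<beta>\<^sup>2)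
      = (\<psi> Q x * \<psi> Q y)\<^sup>2" for Q
  proof -
    \<comment> \<open>With u = p q, this eliminates q^2 - p^2 from X = u \<delta> + \<beta> (q^2 -
      p^2) by means of (q^2 - p^2)^2 = r^2 - 4 u^2.\<close>
    have "\<beta>\<^sup>2 * (r Q)\<^sup>2 + 2 * \<delta> * (X Q * (\<psi> Q x * \<psi> Q y)) - (X Q)\<^sup>2 = (\<psi> Q x * \<psi> Q y)\<^sup>2 * (\<delta>\<^sup>2 + 4 * \<beta>\<^sup>2)"
      unfolding X_def r_def by (simp add: power2_eq_square algebra_simps)
    then show ?thesis using pos by simp
  qed
  ultimately have "((\<lambda>Q. (\<psi> Q x * \<psi> Q y)\<^sup>2) \<longlongrightarrow> \<beta>\<^sup>2 / (\<delta>\<^sup>2 + 4 * \<beta>\<^sup>2)) at_top" by simp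
  from tendsto_real_sqrt[OF this] show ?thesis by (simp add: \<delta>_def)
qed

text \<open>The first nonzero \<alpha> occurs with a positive power of \<mu>, which tends to
  infinity, while the other terms of the mixing equation stay bounded. The product of the well
  entries must therefore vanish in the limit.\<close>

lemma mixing_limit_zero:
  assumes eig: "eventually (\<lambda>Q. eigenpair Q (\<psi> Q) (\<mu> Q) \<and> Q / 2 < \<mu> Q) at_top"
    and m: "m < d - 1" "\<alpha> m \<noteq> 0" and \<alpha>: "\<And>k. k < m \<Longrightarrow> \<alpha> k = 0"
  shows "((\<lambda>Q. \<bar>\<psi> Q x * \<psi> Q y\<bar>) \<longlongrightarrow> 0) at_top"
proof -
  define e where "e = d - 1 - m"
  have e: "0 < e" using m by (simp add: e_def)
  \<comment> \<open>The \<alpha>-sum divided by its leading power \<mu>^e; it tends to the leading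
    coefficient.\<close>
  define R where "R Q = (\<Sum>k\<in>{m..<d}. \<alpha> k / \<mu> Q ^ (k - m))" for Q
  have \<mu>_top: "filterlim \<mu> at_top at_top"
  proof (rule filterlim_at_top_mono)
    show "filterlim (\<lambda>Q::real. 1 / 2 * Q) at_top at_top"
      by (rule filterlim_tendsto_pos_mult_at_top[OF tendsto_const _ filterlim_ident]) simp
    show "eventually (\<lambda>Q. 1 / 2 * Q \<le> \<mu> Q) at_top" using eig by eventually_elim simp
  qed
  have quot: "((\<lambda>Q. c / \<mu> Q ^ k) \<longlongrightarrow> (if k = 0 then c else 0)) at_top" for k c
    by (auto intro!: real_tendsto_divide_at_top filterlim_pow_at_top \<mu>_top)
  have "(R \<longlongrightarrow> (\<Sum>k\<in>{m..<d}. if k - m = 0 then \<alpha> k else 0)) at_top"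
    unfolding R_def by (intro tendsto_sum quot)
  also have "(\<Sum>k\<in>{m..<d}. if k - m = 0 then \<alpha> k else 0) = (\<Sum>k\<in>{m..<d}. if k = m then \<alpha> k else 0)"
    by (intro sum.cong) auto
  also have "\<dots> = \<alpha> m" using m by simp
  finally have R: "(R \<longlongrightarrow> \<alpha> m) at_top" .
  have uR: "((\<lambda>Q. \<psi> Q x * \<psi> Q y * R Q) \<longlongrightarrow> 0) at_top"
  proof (rule Lim_null_comparison)
    show "((\<lambda>Q. (C + 2 * \<beta>) / \<mu> Q ^ e) \<longlongrightarrow> 0) at_top" using quot[of "C + 2 * \<beta>" e] e by simp
    show "eventually (\<lambda>Q. norm (\<psi> Q x * \<psi> Q y * R Q) \<le> (C + 2 * \<beta>) / \<mu> Q ^ e) at_top"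
      using eig eventually_ge_at_top[of 1]
    proof eventually_elim
      case (elim Q)
      have \<mu>: "0 < \<mu> Q" using elim by simp
      have "(\<Sum>k<d. \<alpha> k * \<mu> Q ^ (d - 1 - k)) = (\<Sum>k\<in>{m..<d}. \<alpha> k * \<mu> Q ^ (d - 1 - k))"
        by (rule sum.mono_neutral_right) (use \<alpha> in force)+
      also have "\<dots> = R Q * \<mu> Q ^ e"
        unfolding R_def sum_distrib_right
      proof (rule sum.cong[OF refl])
        fix k assume "k \<in> {m..<d}"
        then have "e = (k - m) + (d - 1 - k)" by (auto simp: e_def)
        then show "\<alpha> k * \<mu> Q ^ (d - 1 - k) = \<alpha> k / \<mu> Q ^ (k - m) * \<mu> Q ^ e"
          using \<mu> by (simp add: power_add)
      qed
      finally have "\<bar>\<psi> Q x * \<psi> Q y * (R Q * \<mu> Q ^ e) + \<beta> * ((\<psi> Q y)\<^sup>2 - (\<psi> Q x)\<^sup>2)\<bar> \<le> C / Q"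
        using mixing_equation[of Q "\<psi> Q" "\<mu> Q"] elim by simp
      moreover have "C / Q \<le> C"
      proof -
        have "C * 1 \<le> C * Q" using elim C_bounds(4) by (intro mult_left_mono) auto
        then show ?thesis using elim by (simp add: divide_le_eq)
      qed
      moreover have "\<bar>\<beta> * ((\<psi> Q y)\<^sup>2 - (\<psi> Q x)\<^sup>2)\<bar> \<le> 2 * \<beta>"
      proof -
        have "(\<psi> Q v)\<^sup>2 \<le> 1" for v
          using eigenpair_abs_le_1[of Q "\<psi> Q" "\<mu> Q" v] elim by (simp add: abs_square_le_1)
        from this[of x] this[of y] have "\<bar>(\<psi> Q y)\<^sup>2 - (\<psi> Q x)\<^sup>2\<bar> \<le> 2"
          by (smt (verit) zero_le_power2)
        then have "\<beta> * \<bar>(\<psi> Q y)\<^sup>2 - (\<psi> Q x)\<^sup>2\<bar> \<le> \<beta> * 2" using reachable by (intro mult_left_mono) auto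
        then show ?thesis using reachable by (simp add: abs_mult)
      qed
      ultimately have "\<bar>\<psi> Q x * \<psi> Q y * R Q * \<mu> Q ^ e\<bar> \<le> C + 2 * \<beta>" by (simp add: mult.assoc)
      then have "\<bar>\<psi> Q x * \<psi> Q y * R Q\<bar> * \<mu> Q ^ e \<le> C + 2 * \<beta>" using \<mu> by (simp add: abs_mult)
      then show ?case using \<mu> by (simp add: pos_le_divide_eq)
    qed
  qed
  \<comment> \<open>Dividing by \<open>R\<close> is legitimate for large \<open>Q\<close>, as its
    limit is nonzero.\<close>
  have "((\<lambda>Q. \<psi> Q x * \<psi> Q y * R Q / R Q) \<longlongrightarrow> 0 / \<alpha> m) at_top"
    by (rule tendsto_divide[OF uR R m(2)])
  moreover have "eventually (\<lambda>Q. \<psi> Q x * \<psi> Q y * R Q / R Q = \<psi> Q x * \<psi> Q y) at_top"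
    using tendsto_imp_eventually_ne[OF R m(2)] by eventually_elim simp
  ultimately have "((\<lambda>Q. \<psi> Q x * \<psi> Q y) \<longlongrightarrow> 0) at_top"
    by (simp add: filterlim_cong)
  then show ?thesis by (rule tendsto_rabs_zero)
qed

text \<open>In the gap equation the determinant has modulus tending to 1, the entries at
  \<open>x\<close> stay away from 0 because \<kappa> > 0, and \<mu>1 is comparable to
  \<open>Q\<close>. Hence the gap times Q^(d-1) lies between positive constants.\<close>

lemma gap_bounds:
  assumes pair: "eventually (\<lambda>Q. two_level_pair (F Q) Q (\<psi>1 Q) (\<mu>1 Q) (\<psi>2 Q) (\<mu>2 Q)) at_top"
    and lim: "((\<lambda>Q. \<bar>\<psi>1 Q x * \<psi>1 Q y\<bar>) \<longlongrightarrow> \<kappa>) at_top" "((\<lambda>Q. \<bar>\<psi>2 Q x * \<psi>2 Q y\<bar>) \<longlongrightarrow> \<kappa>) at_top"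
    and \<kappa>: "\<kappa> > 0"
  obtains c1 c2 where "0 < c1" "eventually (\<lambda>Q. c1 \<le> \<bar>\<mu>2 Q - \<mu>1 Q\<bar> * Q ^ (d - 1)) at_top"
    "eventually (\<lambda>Q. \<bar>\<mu>2 Q - \<mu>1 Q\<bar> * Q ^ (d - 1) \<le> c2) at_top"
proof -
  let ?D = "\<lambda>Q. \<psi>2 Q y * \<psi>1 Q x - \<psi>2 Q x * \<psi>1 Q y"
  define r1 where "r1 Q = (\<psi>1 Q x)\<^sup>2 + (\<psi>1 Q y)\<^sup>2" for Q
  define r2 where "r2 Q = (\<psi>2 Q x)\<^sup>2 + (\<psi>2 Q y)\<^sup>2" for Q
  define o12 where "o12 Q = \<psi>1 Q x * \<psi>2 Q x + \<psi>1 Q y * \<psi>2 Q y" for Q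
  have "((\<lambda>Q. r1 Q - 1) \<longlongrightarrow> 0) at_top" "((\<lambda>Q. r2 Q - 1) \<longlongrightarrow> 0) at_top" and o: "(o12 \<longlongrightarrow> 0) at_top"
    by (rule tendsto_zero_of_le_const_div[of _ C], rule eventually_mono[OF pair],
        simp add: r1_def r2_def o12_def two_level_pair_def)+
  then have r: "(r1 \<longlongrightarrow> 1) at_top" "(r2 \<longlongrightarrow> 1) at_top" by (simp_all add: LIM_zero_iff)
  have "((\<lambda>Q. r1 Q * r2 Q - (o12 Q)\<^sup>2) \<longlongrightarrow> 1 * 1 - 0\<^sup>2) at_top" by (intro tendsto_intros r o)
  \<comment> \<open>Lagrange's identity: two nearly orthonormal vectors in the plane have
    determinant close to 1 in modulus.\<close>
  moreover have "r1 Q * r2 Q - (o12 Q)\<^sup>2 = (?D Q)\<^sup>2" for Q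
    by (simp add: r1_def r2_def o12_def power2_eq_square algebra_simps)
  ultimately have "((\<lambda>Q. (?D Q)\<^sup>2) \<longlongrightarrow> 1) at_top" by simp
  from tendsto_real_sqrt[OF this] have D: "((\<lambda>Q. \<bar>?D Q\<bar>) \<longlongrightarrow> 1) at_top" by simp
  have CQ: "((\<lambda>Q. C / Q) \<longlongrightarrow> 0) at_top"
    by (rule real_tendsto_divide_at_top[OF tendsto_const filterlim_ident])
  have ev: "eventually (\<lambda>Q. 1/2 < \<bar>?D Q\<bar>) at_top" "eventually (\<lambda>Q. \<bar>?D Q\<bar> < 2) at_top"
    "eventually (\<lambda>Q. \<kappa>/2 < \<bar>\<psi>1 Q x * \<psi>1 Q y\<bar>) at_top" "eventually (\<lambda>Q. \<kappa>/2 < \<bar>\<psi>2 Q x * \<psi>2 Q y\<bar>) at_top"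
    "eventually (\<lambda>Q. C / Q < min (min (\<kappa>/4) (\<beta>/4)) 1) at_top"
    using \<kappa> reachable
    by (intro order_tendstoD[OF D] order_tendstoD[OF lim(1)] order_tendstoD[OF lim(2)] order_tendstoD[OF CQ]; simp)+
  \<comment> \<open>The factor at \<open>x\<close> lies between (\<kappa>/2)(\<kappa>/4) and 2, the
    right side between \<beta>/4 and 3 \<beta>, and \<mu>1 between Q / 2 and 2 Q.\<close>
  have *: "eventually (\<lambda>Q. \<beta> / 4 \<le> \<bar>\<mu>2 Q - \<mu>1 Q\<bar> * 2 * (2 * Q) ^ (d - 1)
      \<and> \<bar>\<mu>2 Q - \<mu>1 Q\<bar> * (\<kappa> / 2 * (\<kappa> / 4)) * (Q / 2) ^ (d - 1) \<le> 3 * \<beta>) at_top"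
    using pair ev eventually_ge_at_top[of "max 2 C"]
  proof eventually_elim
    case (elim Q)
    let ?p1 = "\<psi>1 Q x" and ?p2 = "\<psi>2 Q x" and ?G = "\<mu>2 Q - \<mu>1 Q" and ?m = "\<mu>1 Q"
    have Q: "2 \<le> Q" "C \<le> Q" using elim by auto
    have eig: "eigenpair Q (\<psi>1 Q) ?m" "Q / 2 < ?m" "\<bar>?m - Q\<bar> \<le> C" "eigenpair Q (\<psi>2 Q) (\<mu>2 Q)" "Q / 2 < \<mu>2 Q"
      using elim by (auto simp: two_level_pair_def)
    have D': "1/2 < \<bar>?D Q\<bar>" "\<bar>?D Q\<bar> < 2" and pq: "\<kappa>/2 < \<bar>?p1 * \<psi>1 Q y\<bar>" "\<kappa>/2 < \<bar>?p2 * \<psi>2 Q y\<bar>"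
      and small: "C / Q < \<kappa>/4" "C / Q < \<beta>/4" "C / Q < 1" using elim \<kappa> reachable by auto
    obtain \<eta> r where \<eta>: "\<bar>\<eta>\<bar> \<le> C / Q" "\<bar>r\<bar> \<le> C / Q"
      and eq: "?p1 * ?G * (?p2 + \<eta>) * ?m ^ (d - 1) = \<beta> * ?D Q + r"
      using gap_equation[OF eig(1) Q(1) eig(2,4,5)] by blast
    have m: "Q / 2 \<le> ?m" "?m \<le> 2 * Q" using eig(2,3) Q by linarith+
    \<comment> \<open>The entry at \<open>y\<close> has modulus at most 1, so the bound on the
      product passes to the entry at \<open>x\<close>.\<close>
    have p1: "\<kappa>/2 \<le> \<bar>?p1\<bar>" "\<bar>?p1\<bar> \<le> 1"
      using pq(1) eigenpair_mult_le[OF eig(1), of ?p1 "\<bar>?p1\<bar>" y] eigenpair_abs_le_1[OF eig(1), of x]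
      by (auto simp: mult.commute)
    have p2: "\<kappa>/2 \<le> \<bar>?p2\<bar>" "\<bar>?p2\<bar> \<le> 1"
      using pq(2) eigenpair_mult_le[OF eig(4), of ?p2 "\<bar>?p2\<bar>" y] eigenpair_abs_le_1[OF eig(4), of x]
      by (auto simp: mult.commute)
    have p2\<eta>: "\<kappa>/4 \<le> \<bar>?p2 + \<eta>\<bar>" "\<bar>?p2 + \<eta>\<bar> \<le> 2" using p2 \<eta> small by linarith+
    have prod: "\<kappa>/2 * (\<kappa>/4) \<le> \<bar>?p1\<bar> * \<bar>?p2 + \<eta>\<bar>" "\<bar>?p1\<bar> * \<bar>?p2 + \<eta>\<bar> \<le> 1 * 2"
      using p1 p2\<eta> \<kappa> by (intro mult_mono; simp)+
    have abs_eq: "\<bar>?G\<bar> * (\<bar>?p1\<bar> * \<bar>?p2 + \<eta>\<bar>) * ?m ^ (d - 1) = \<bar>\<beta> * ?D Q + r\<bar>"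
      unfolding eq[symmetric] using m Q by (simp add: abs_mult mult_ac)
    have "\<beta> * (1/2) \<le> \<beta> * \<bar>?D Q\<bar>" "\<beta> * \<bar>?D Q\<bar> \<le> \<beta> * 2"
      using D' reachable by (intro mult_left_mono; simp)+
    then have "\<beta> / 2 \<le> \<bar>\<beta> * ?D Q\<bar>" "\<bar>\<beta> * ?D Q\<bar> \<le> 2 * \<beta>"
      using reachable by (simp_all add: abs_mult)
    then have rhs: "\<beta> / 4 \<le> \<bar>\<beta> * ?D Q + r\<bar>" "\<bar>\<beta> * ?D Q + r\<bar> \<le> 3 * \<beta>"
      using \<eta>(2) small(2) reachable by linarith+
    have pw: "(Q / 2) ^ (d - 1) \<le> ?m ^ (d - 1)" "?m ^ (d - 1) \<le> (2 * Q) ^ (d - 1)"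
      using m Q by (intro power_mono; simp)+
    have "\<bar>?G\<bar> * (\<bar>?p1\<bar> * \<bar>?p2 + \<eta>\<bar>) * ?m ^ (d - 1) \<le> \<bar>?G\<bar> * 2 * (2 * Q) ^ (d - 1)"
      using prod pw m Q by (intro mult_mono) auto
    moreover have "\<bar>?G\<bar> * (\<kappa>/2 * (\<kappa>/4)) * (Q / 2) ^ (d - 1) \<le> \<bar>?G\<bar> * (\<bar>?p1\<bar> * \<bar>?p2 + \<eta>\<bar>) * ?m ^ (d - 1)"
      using p1 p2\<eta> pw m Q \<kappa> by (intro mult_mono) auto
    ultimately show ?case using abs_eq rhs by linarith
  qed
  show thesis
  proof
    show "0 < \<beta> / (8 * 2 ^ (d - 1))" using reachable by simp
    show "eventually (\<lambda>Q. \<beta> / (8 * 2 ^ (d - 1)) \<le> \<bar>\<mu>2 Q - \<mu>1 Q\<bar> * Q ^ (d - 1)) at_top"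
      using * by eventually_elim (simp add: power_mult_distrib field_simps)
    show "eventually (\<lambda>Q. \<bar>\<mu>2 Q - \<mu>1 Q\<bar> * Q ^ (d - 1) \<le> 3 * \<beta> * 2 ^ (d - 1) / (\<kappa> / 2 * (\<kappa> / 4))) at_top"
      using * by eventually_elim (use \<kappa> in \<open>simp add: power_divide field_simps\<close>)
  qed
qed

end

section \<open>Tunneling coefficients\<close>

context double_well_distance
begin

text \<open>\<open>F Q t\<close> stands for the modulus of the state at \<open>y\<close>. Its
  formula is required in every eigenbasis, since the one actually used is chosen later; the graph
  itself no longer enters.\<close>

context
  fixes F :: "real \<Rightarrow> real \<Rightarrow> real"
  assumes F_nonneg: "\<And>Q t. 0 \<le> F Q t"
    and F_eigenbasis: "\<And>Q \<psi> \<mu>. (\<And>j v. (\<Sum>w\<in>UNIV. K Q v w * \<psi> j w) = \<mu> j * \<psi> j v) \<Longrightarrow>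
      (\<And>v w. (\<Sum>j\<in>UNIV. \<psi> j v * \<psi> j w) = (if v = w then 1 else 0)) \<Longrightarrow>
      F Q = (\<lambda>t. cmod (\<Sum>k\<in>(UNIV::'a set). cis (t * (1 - \<mu> k)) * complex_of_real (\<psi> k y * \<psi> k x)))"
begin

lemma ex_two_level_family:
  obtains \<psi>1 \<mu>1 \<psi>2 \<mu>2 where
    "eventually (\<lambda>Q. two_level_pair (F Q) Q (\<psi>1 Q) (\<mu>1 Q) (\<psi>2 Q) (\<mu>2 Q)) at_top"
proof -
  \<comment> \<open>One tuple-valued choice keeps the two eigenpairs together; below the threshold
    its values are arbitrary.\<close>
  have "\<forall>Q. \<exists>q. 4 * real CARD('a) ^ 2 \<le> Q \<longrightarrow>
      two_level_pair (F Q) Q (fst q) (fst (snd q)) (fst (snd (snd q))) (snd (snd (snd q)))"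
    using ex_two_level_pair[OF _ F_eigenbasis] by fastforce
  then obtain q where q: "\<And>Q. 4 * real CARD('a) ^ 2 \<le> Q \<Longrightarrow>
      two_level_pair (F Q) Q (fst (q Q)) (fst (snd (q Q))) (fst (snd (snd (q Q)))) (snd (snd (snd (q Q))))"
    by metis
  show thesis
    by (rule that, rule eventually_mono[OF eventually_ge_at_top q])
qed

lemma two_level_pair_approx:
  assumes "eventually (\<lambda>Q. two_level_pair (F Q) Q (\<psi>1 Q) (\<mu>1 Q) (\<psi>2 Q) (\<mu>2 Q)) at_top"
  shows "eventually (\<lambda>Q. \<forall>t\<ge>0. \<bar>F Q t - \<bar>\<psi>1 Q x * \<psi>1 Q y\<bar> * cmod (cis (t * (\<mu>2 Q - \<mu>1 Q)) - 1)\<bar>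
      \<le> 2 * C / Q) at_top"
  using assms by eventually_elim (simp add: two_level_pair_def)

lemma error_tendsto_zero: "((\<lambda>Q. 2 * C / Q) \<longlongrightarrow> 0) at_top"
  by (rule real_tendsto_divide_at_top[OF tendsto_const filterlim_ident])

lemma no_tunneling_Liminf:
  assumes m: "m < d - 1" "\<alpha> m \<noteq> 0" and \<alpha>: "\<And>k. k < m \<Longrightarrow> \<alpha> k = 0"
  shows "Liminf at_top (\<lambda>Q. SUP t\<in>{0..}. ereal ((F Q t)\<^sup>2)) = 0"
proof -
  obtain \<psi>1 \<mu>1 \<psi>2 \<mu>2 where
    pair: "eventually (\<lambda>Q. two_level_pair (F Q) Q (\<psi>1 Q) (\<mu>1 Q) (\<psi>2 Q) (\<mu>2 Q)) at_top"
    by (rule ex_two_level_family)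
  have "((\<lambda>Q. \<bar>\<psi>1 Q x * \<psi>1 Q y\<bar>) \<longlongrightarrow> 0) at_top"
    by (rule mixing_limit_zero[OF eventually_mono[OF pair] m \<alpha>]) (auto simp: two_level_pair_def)
  then show ?thesis
    by (intro two_level_Liminf_zero[OF F_nonneg two_level_pair_approx[OF pair] _ _ error_tendsto_zero]) auto
qed

text \<open>The lower gap bound puts a half period within time of order Q^(d-1), where the full
  amplitude is reached; the upper gap bound shows that no shorter order suffices.\<close>

lemma tunneling_Liminf:
  assumes \<alpha>: "\<And>k. k < d - 1 \<Longrightarrow> \<alpha> k = 0"
  defines "L \<equiv> ereal (4 * (\<beta>\<^sup>2 / ((\<alpha> (d - 1))\<^sup>2 + 4 * \<beta>\<^sup>2)))"
  shows "Liminf at_top (\<lambda>Q. SUP t\<in>{0..}. ereal ((F Q t)\<^sup>2)) = L"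
    and "\<exists>f\<in>O[at_top](\<lambda>Q. Q ^ (d - 1)). Liminf at_top (\<lambda>Q. SUP t\<in>{0..f Q}. ereal ((F Q t)\<^sup>2)) = L"
    and "\<forall>f\<in>o[at_top](\<lambda>Q. Q ^ (d - 1)). Liminf at_top (\<lambda>Q. SUP t\<in>{0..f Q}. ereal ((F Q t)\<^sup>2)) \<le> 0"
proof -
  define \<kappa> where "\<kappa> = sqrt (\<beta>\<^sup>2 / ((\<alpha> (d - 1))\<^sup>2 + 4 * \<beta>\<^sup>2))"
  have "0 < (\<alpha> (d - 1))\<^sup>2 + 4 * \<beta>\<^sup>2" using reachable by (intro add_nonneg_pos) auto
  then have \<kappa>: "0 < \<kappa>" and L: "L = ereal (4 * \<kappa>\<^sup>2)"
    using reachable by (simp_all add: \<kappa>_def L_def)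
  obtain \<psi>1 \<mu>1 \<psi>2 \<mu>2 where
    pair: "eventually (\<lambda>Q. two_level_pair (F Q) Q (\<psi>1 Q) (\<mu>1 Q) (\<psi>2 Q) (\<mu>2 Q)) at_top"
    by (rule ex_two_level_family)
  have lim1: "((\<lambda>Q. \<bar>\<psi>1 Q x * \<psi>1 Q y\<bar>) \<longlongrightarrow> \<kappa>) at_top" unfolding \<kappa>_def
    by (rule mixing_limit[OF eventually_mono[OF pair] \<alpha>]) (auto simp: two_level_pair_def)
  have lim2: "((\<lambda>Q. \<bar>\<psi>2 Q x * \<psi>2 Q y\<bar>) \<longlongrightarrow> \<kappa>) at_top" unfolding \<kappa>_def
    by (rule mixing_limit[OF eventually_mono[OF pair] \<alpha>]) (auto simp: two_level_pair_def)
  obtain c1 c2 where c1: "0 < c1"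
    and low: "eventually (\<lambda>Q. c1 \<le> \<bar>\<mu>2 Q - \<mu>1 Q\<bar> * Q ^ (d - 1)) at_top"
    and up: "eventually (\<lambda>Q. \<bar>\<mu>2 Q - \<mu>1 Q\<bar> * Q ^ (d - 1) \<le> c2) at_top"
    by (rule gap_bounds[OF pair lim1 lim2 \<kappa>])
  note two_level = F_nonneg two_level_pair_approx[OF pair] always_eventually[OF allI[OF abs_ge_zero]]
    lim1 error_tendsto_zero
  \<comment> \<open>By the lower gap bound this dominates the half period pi / |\<mu>2 -
    \<mu>1|.\<close>
  define f where "f Q = pi / c1 * Q ^ (d - 1)" for Q
  have time: "eventually (\<lambda>Q. \<mu>2 Q - \<mu>1 Q \<noteq> 0 \<and> pi / \<bar>\<mu>2 Q - \<mu>1 Q\<bar> \<in> {0..f Q}) at_top"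
    using low
  proof eventually_elim
    case (elim Q)
    then have nz: "\<mu>2 Q - \<mu>1 Q \<noteq> 0" using c1 by auto
    have "pi * c1 \<le> pi * (\<bar>\<mu>2 Q - \<mu>1 Q\<bar> * Q ^ (d - 1))" using elim by (intro mult_left_mono) auto
    then have "pi / \<bar>\<mu>2 Q - \<mu>1 Q\<bar> \<le> f Q" using nz c1 by (simp add: f_def divide_simps mult_ac)
    then show ?case using nz by simp
  qed
  show "Liminf at_top (\<lambda>Q. SUP t\<in>{0..}. ereal ((F Q t)\<^sup>2)) = L"
    unfolding L by (rule two_level_Liminf[OF two_level eventually_mono[OF time] \<kappa>]) auto
  have "Liminf at_top (\<lambda>Q. SUP t\<in>{0..f Q}. ereal ((F Q t)\<^sup>2)) = L"
    unfolding L by (rule two_level_Liminf[OF two_level eventually_mono[OF time] \<kappa>]) auto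
  moreover have "f \<in> O[at_top](\<lambda>Q. Q ^ (d - 1))" unfolding f_def by (rule landau_o.big.cmult_in_iff[THEN iffD2]) (use c1 in auto)
  ultimately show "\<exists>f\<in>O[at_top](\<lambda>Q. Q ^ (d - 1)). Liminf at_top (\<lambda>Q. SUP t\<in>{0..f Q}. ereal ((F Q t)\<^sup>2)) = L"
    by blast
  show "\<forall>f\<in>o[at_top](\<lambda>Q. Q ^ (d - 1)). Liminf at_top (\<lambda>Q. SUP t\<in>{0..f Q}. ereal ((F Q t)\<^sup>2)) \<le> 0"
    by (intro ballI two_level_Liminf_short_time[OF two_level up])
qed

end

end

section \<open>Walks and cospectrality\<close>

lemma mat_pow_Suc_right:
  fixes A :: "'a::finite \<Rightarrow> 'a \<Rightarrow> real"
  shows "mat_pow A (Suc k) v w = (\<Sum>u\<in>UNIV. mat_pow A k v u * A u w)"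
proof (induction k arbitrary: v)
  case 0
  have "(\<Sum>u\<in>UNIV. mat_pow A 0 v u * A u w) = (\<Sum>u\<in>UNIV. if v = u then A u w else 0)"
    by (intro sum.cong) auto
  moreover have "mat_pow A (Suc 0) v w = (\<Sum>u\<in>UNIV. if u = w then A v u else 0)"
    unfolding mat_pow.simps mat_mult_def by (intro sum.cong) auto
  ultimately show ?case by simp
next
  case (Suc k)
  have "mat_pow A (Suc (Suc k)) v w = (\<Sum>s\<in>UNIV. \<Sum>u\<in>UNIV. A v s * (mat_pow A k s u * A u w))"
    using Suc by (simp only: mat_pow.simps(2)[of A "Suc k"] mat_mult_def sum_distrib_left)
  also have "\<dots> = (\<Sum>u\<in>UNIV. \<Sum>s\<in>UNIV. A v s * (mat_pow A k s u * A u w))" by (rule sum.swap)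
  finally show ?case by (simp add: mat_mult_def sum_distrib_right mult.assoc)
qed

lemma mat_pow_symmetric:
  fixes A :: "'a::finite \<Rightarrow> 'a \<Rightarrow> real"
  assumes "\<And>v w. A v w = A w v"
  shows "mat_pow A k v w = mat_pow A k w v"
proof (induction k arbitrary: v w)
  case (Suc k)
  have "mat_pow A (Suc k) v w = (\<Sum>u\<in>UNIV. mat_pow A k v u * A u w)" by (rule mat_pow_Suc_right)
  also have "\<dots> = (\<Sum>u\<in>UNIV. A w u * mat_pow A k u v)"
    by (intro sum.cong refl) (simp add: assms[of _ w] Suc[of v] mult.commute)
  finally show ?case by (simp add: mat_mult_def)
qed auto

text \<open>Nonnegative entries exclude cancellation, so a power entry is nonzero as soon as one
  walk contributes.\<close>

lemma mat_pow_nonzero_iff_walk: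
  fixes A :: "'a::finite \<Rightarrow> 'a \<Rightarrow> real"
  assumes nn: "\<And>v w. 0 \<le> A v w" and supp: "\<And>v w. A v w \<noteq> 0 \<longleftrightarrow> E v w"
  shows "mat_pow A k u v \<noteq> 0 \<longleftrightarrow> (\<exists>p. is_walk E p k u v)"
proof (induction k arbitrary: u)
  case 0
  show ?case by (auto simp: is_walk_def)
next
  case (Suc k)
  have "mat_pow A (Suc k) u v \<noteq> 0 \<longleftrightarrow> (\<exists>w. A u w * mat_pow A k w v \<noteq> 0)"
    by (simp add: mat_mult_def sum_nonneg_eq_0_iff nn mat_pow_nonneg)
  also have "\<dots> \<longleftrightarrow> (\<exists>w p. E u w \<and> is_walk E p k w v)" using Suc supp by auto
  also have "\<dots> \<longleftrightarrow> (\<exists>p. is_walk E p (Suc k) u v)"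
  proof
    assume "\<exists>w p. E u w \<and> is_walk E p k w v"
    then obtain w p where "E u w" "is_walk E p k w v" by blast
    then have "is_walk E (case_nat u p) (Suc k) u v"
      by (auto simp: is_walk_def split: nat.split)
    then show "\<exists>p. is_walk E p (Suc k) u v" by blast
  next
    assume "\<exists>p. is_walk E p (Suc k) u v"
    then obtain p where "is_walk E p (Suc k) u v" by blast
    then have "E u (p 1) \<and> is_walk E (\<lambda>i. p (Suc i)) k (p 1) v"
      by (auto simp: is_walk_def)
    then show "\<exists>w p. E u w \<and> is_walk E p k w v" by blast
  qed
  finally show ?case .
qed

section \<open>Cospectrality and its link to the normalized adjacency\<close>

lemma m_cospectral_mono: "m_cospectral E m x y \<Longrightarrow> k \<le> m \<Longrightarrow> m_cospectral E k x y"
  by (auto simp: m_cospectral_def)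

text \<open>Cospectrality levels are closed downwards and contain 0, so when some level fails they
  are bounded and the \<open>GREATEST\<close> is attained. All case conditions can thus be phrased
  with \<open>m_cospectral\<close>.\<close>

lemma cospectrality_ge_iff: "enat m \<le> cospectrality E x y \<longleftrightarrow> m_cospectral E m x y"
proof (cases "\<forall>m. m_cospectral E m x y")
  case True
  then show ?thesis by (simp add: cospectrality_def)
next
  case False
  then obtain b where b: "\<not> m_cospectral E b x y" by blast
  have bound: "k \<le> b" if "m_cospectral E k x y" for k
    using b m_cospectral_mono[OF that] by (meson nle_le)
  have "m_cospectral E 0 x y" by (simp add: m_cospectral_def PR_def)
  then have "m_cospectral E (GREATEST m. m_cospectral E m x y) x y"
    by (rule GreatestI_nat) (rule bound)
  moreover have "k \<le> (GREATEST m. m_cospectral E m x y)" if "m_cospectral E k x y" for k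
    by (rule Greatest_le_nat[where P = "\<lambda>m. m_cospectral E m x y", OF that]) (rule bound)
  moreover have "cospectrality E x y = enat (GREATEST m. m_cospectral E m x y)"
    using False by (simp add: cospectrality_def)
  ultimately show ?thesis using m_cospectral_mono by auto
qed

definition normalized_adjacency :: "('a::finite \<Rightarrow> 'a \<Rightarrow> bool) \<Rightarrow> 'a \<Rightarrow> 'a \<Rightarrow> real" where
  "normalized_adjacency E v w = (if E v w then 1 / sqrt (real (deg E v * deg E w)) else 0)"

lemma deg_pos: "E v w \<Longrightarrow> 0 < deg E v"
  by (auto simp: deg_def card_gt_0_iff)

text \<open>Having two distinct vertices guarantees a target different from \<open>v\<close>; the
  first step of a walk to it is an edge.\<close>

lemma connected_deg_pos:
  fixes E :: "'a::finite \<Rightarrow> 'a \<Rightarrow> bool" and x y :: 'a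
  assumes "connected_graph E" "x \<noteq> y"
  shows "0 < deg E v"
proof -
  define u where "u = (if v = x then y else x)"
  have u: "u \<noteq> v" using assms(2) by (auto simp: u_def)
  obtain p k where p: "is_walk E p k v u" using assms(1) unfolding connected_graph_def by blast
  then have "0 < k" using u by (cases k) (auto simp: is_walk_def)
  then have "E v (p 1)" using p by (auto simp: is_walk_def)
  then show ?thesis by (rule deg_pos)
qed

text \<open>The walk matrix is the normalized adjacency conjugated by the diagonal matrix of square
  roots of degrees. The diagonal entries of all powers therefore agree.\<close>

lemma mat_pow_rw_matrix:
  assumes pos: "\<And>v. 0 < deg E v"
  shows "mat_pow (rw_matrix E) k v w * sqrt (real (deg E v))
       = mat_pow (normalized_adjacency E) k v w * sqrt (real (deg E w))"
proof (induction k arbitrary: v)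
  case (Suc k)
  have step: "rw_matrix E v u * sqrt (real (deg E v)) = normalized_adjacency E v u * sqrt (real (deg E u))" for u
  proof -
    have "sqrt (real (deg E v)) \<noteq> 0" "sqrt (real (deg E u)) \<noteq> 0" using pos[of v] pos[of u] by auto
    moreover have "real (deg E v) = sqrt (real (deg E v)) * sqrt (real (deg E v))" by simp
    ultimately show ?thesis
      by (simp add: rw_matrix_def normalized_adjacency_def real_sqrt_mult divide_simps)
  qed
  have "mat_pow (rw_matrix E) (Suc k) v w * sqrt (real (deg E v))
      = (\<Sum>u\<in>UNIV. rw_matrix E v u * sqrt (real (deg E v)) * mat_pow (rw_matrix E) k u w)"
    unfolding mat_pow.simps mat_mult_def sum_distrib_right by (simp only: mult_ac)
  also have "\<dots> = (\<Sum>u\<in>UNIV. normalized_adjacency E v u * (mat_pow (rw_matrix E) k u w * sqrt (real (deg E u))))"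
    by (simp only: step mult_ac)
  also have "\<dots> = (\<Sum>u\<in>UNIV. normalized_adjacency E v u * (mat_pow (normalized_adjacency E) k u w * sqrt (real (deg E w))))"
    by (simp only: Suc)
  finally show ?case unfolding mat_pow.simps mat_mult_def sum_distrib_right by (simp only: mult_ac)
qed simp

lemma PR_eq_normalized:
  assumes pos: "\<And>v. 0 < deg E v"
  shows "PR E v k = mat_pow (normalized_adjacency E) k v v"
  using mat_pow_rw_matrix[OF pos, of k v v] pos[of v] by (simp add: PR_def)

section \<open>The three tunneling regimes and the time scale for a graph\<close>

theorem theorem1:
  fixes E :: "'a::finite \<Rightarrow> 'a \<Rightarrow> bool" and x y :: 'a
  assumes sym: "\<And>v w. E v w \<Longrightarrow> E w v"
    and irrefl: "\<And>v. \<not> E v v"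
    and conn: "connected_graph E"
    and xy: "x \<noteq> y"
  defines "d \<equiv> gdist E x y"
    and "W \<equiv> (\<lambda>v. if v = x \<or> v = y then 1 else 0 :: real)"
  shows "(cospectrality E x y \<ge> enat d \<longrightarrow> TC E W x y = 1 \<and> TC E W y x = 1)
       \<and> (cospectrality E x y = enat (d - 1) \<longrightarrow>
            0 < TC E W x y \<and> TC E W x y < 1 \<and> 0 < TC E W y x \<and> TC E W y x < 1)
       \<and> (cospectrality E x y < enat (d - 1) \<longrightarrow> TC E W x y = 0 \<and> TC E W y x = 0)
       \<and> (cospectrality E x y \<ge> enat (d - 1) \<longrightarrow>
            tunneling_time_Theta E W (\<lambda>Q. Q ^ (d - 1)) x y \<and>
            tunneling_time_Theta E W (\<lambda>Q. Q ^ (d - 1)) y x)"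
proof -
  let ?A = "normalized_adjacency E"
  have pos: "0 < deg E v" for v by (rule connected_deg_pos[OF conn xy])
  have A_sym: "?A v w = ?A w v" for v w
    using sym[of v w] sym[of w v] by (auto simp: normalized_adjacency_def mult.commute)
  have A_nonneg: "0 \<le> ?A v w" for v w by (simp add: normalized_adjacency_def)
  have A_le_1: "?A v w \<le> 1" for v w
  proof -
    have "1 \<le> deg E v * deg E w" using pos[of v] pos[of w] by (simp add: Suc_leI)
    then have "1 \<le> real (deg E v * deg E w)" by linarith
    then show ?thesis by (simp add: normalized_adjacency_def real_sqrt_ge_one del: of_nat_mult)
  qed
  have supp: "?A v w \<noteq> 0 \<longleftrightarrow> E v w" for v w
    using pos[of v] pos[of w] by (simp add: normalized_adjacency_def)
  note walk = mat_pow_nonzero_iff_walk[of ?A E, OF A_nonneg supp]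
  note pow_sym = mat_pow_symmetric[of ?A, OF A_sym]
  have ex: "\<exists>k p. is_walk E p k x y" using conn unfolding connected_graph_def by blast
  have least: "\<exists>p. is_walk E p d x y" unfolding d_def gdist_def using ex by (rule LeastI_ex)
  have below: "\<not> (\<exists>p. is_walk E p k x y)" if "k < d" for k
    using not_less_Least that unfolding d_def gdist_def by blast
  interpret double_well_distance ?A x y d
  proof
    show "0 < d" using least xy by (cases d) (auto simp: is_walk_def)
    show "mat_pow ?A k y x = 0" if "k < d" for k
      using below[OF that] walk[of k x y] pow_sym[of k x y] by metis
    show "mat_pow ?A d y x > 0"
      using least walk[of d x y] pow_sym[of d x y] mat_pow_nonneg[of ?A d y x, OF A_nonneg] by force
  qed (rule A_sym A_nonneg A_le_1 xy pow_sym)+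
  \<comment> \<open>On the diagonal the normalized adjacency is 0, since there are no loops.\<close>
  have H: "hamiltonian E W Q v w = (if v = w then 1 else 0) - K Q v w" for Q v w
    using irrefl[of v] by (auto simp: hamiltonian_def laplacian_def K_def W_def normalized_adjacency_def)
  have state: "state E W Q u t v = (\<Sum>j\<in>UNIV. cis (t * (1 - \<mu> j)) * complex_of_real (\<psi> j v * \<psi> j u))"
    if eig: "\<And>j v. (\<Sum>w\<in>UNIV. K Q v w * \<psi> j w) = \<mu> j * \<psi> j v"
      and compl: "\<And>v w. (\<Sum>j\<in>UNIV. \<psi> j v * \<psi> j w) = (if v = w then 1 else 0)" for Q u t v \<psi> and \<mu> :: "'a \<Rightarrow> real"
  proof (rule state_eigenbasis[OF _ compl])
    fix j v
    have "(\<Sum>w\<in>UNIV. hamiltonian E W Q v w * \<psi> j w)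
        = (\<Sum>w\<in>UNIV. (if v = w then \<psi> j w else 0) - K Q v w * \<psi> j w)"
      by (intro sum.cong) (auto simp: H algebra_simps)
    then show "(\<Sum>w\<in>UNIV. hamiltonian E W Q v w * \<psi> j w) = (1 - \<mu> j) * \<psi> j v"
      by (simp add: sum_subtractf eig left_diff_distrib)
  qed
  \<comment> \<open>The spectral formula is symmetric in the two wells, so one direction of
    tunneling settles both.\<close>
  have state_sym: "state E W Q y t x = state E W Q x t y" for Q t
  proof -
    obtain \<psi> :: "'a \<Rightarrow> 'a \<Rightarrow> real" and \<mu> :: "'a \<Rightarrow> real" where
      basis: "\<And>j v. (\<Sum>w\<in>UNIV. K Q v w * \<psi> j w) = \<mu> j * \<psi> j v"
        "\<And>i j. (\<Sum>v\<in>UNIV. \<psi> i v * \<psi> j v) = (if i = j then 1 else 0)"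
        "\<And>v w. (\<Sum>j\<in>UNIV. \<psi> j v * \<psi> j w) = (if v = w then 1 else 0)"
      using symmetric_matrix_eigenbasis[of "K Q", OF K_sym] by blast
    from state[OF basis(1,3)] show ?thesis by (simp add: mult.commute)
  qed
  have TC_sym: "TC E W y x = TC E W x y" and TC_within_sym: "TC_within E W f y x = TC_within E W f x y" for f
    by (simp_all add: TC_def TC_within_def state_sym)
  define F where "F = (\<lambda>Q t. cmod (state E W Q x t y))"
  have F_nonneg: "0 \<le> F Q t" for Q t by (simp add: F_def)
  have F: "F Q = (\<lambda>t. cmod (\<Sum>k\<in>(UNIV::'a set). cis (t * (1 - \<mu> k)) * complex_of_real (\<psi> k y * \<psi> k x)))"
    if "\<And>j v. (\<Sum>w\<in>UNIV. K Q v w * \<psi> j w) = \<mu> j * \<psi> j v"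
      "\<And>v w. (\<Sum>j\<in>UNIV. \<psi> j v * \<psi> j w) = (if v = w then 1 else 0)" for Q \<psi> \<mu>
    unfolding F_def by (simp only: state[OF that])
  have TC_F: "TC E W x y = Liminf at_top (\<lambda>Q. SUP t\<in>{0..}. ereal ((F Q t)\<^sup>2))"
    and TC_within_F: "TC_within E W f x y = Liminf at_top (\<lambda>Q. SUP t\<in>{0..f Q}. ereal ((F Q t)\<^sup>2))" for f
    by (simp_all add: TC_def TC_within_def F_def)
  have unreachable': "mat_pow ?A k x y = 0" if "k < d" for k
    using unreachable[OF that] mat_pow_sym by simp
  have co_iff: "m_cospectral E m x y \<longleftrightarrow> (\<forall>k\<le>m. mat_pow ?A k x x = mat_pow ?A k y y)" for m
    by (simp add: m_cospectral_def PR_eq_normalized[OF pos])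
  have \<alpha>_zero: "\<alpha> k = 0" if "m_cospectral E m x y" "m \<le> d" "k < m" for m k
    using first_hit_eq_of_cospectral[OF unreachable unreachable' that(2)] that by (simp add: co_iff)
  have \<alpha>_nonzero: "\<alpha> m \<noteq> 0" if "m_cospectral E m x y" "\<not> m_cospectral E (Suc m) x y" "m < d" for m
  proof -
    have "mat_pow ?A (Suc m) x x \<noteq> mat_pow ?A (Suc m) y y"
      using that(1,2) unfolding co_iff by (metis le_Suc_eq)
    then show ?thesis
      using first_hit_diff_of_cospectral[OF unreachable unreachable' that(3)] that(1) unfolding co_iff by simp
  qed
  \<comment> \<open>The limiting coefficient: it is 1 if the last \<alpha> vanishes and lies
    strictly between 0 and 1 otherwise.\<close>
  define L where "L = 4 * (\<beta>\<^sup>2 / ((\<alpha> (d - 1))\<^sup>2 + 4 * \<beta>\<^sup>2))"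
  have denom: "0 < (\<alpha> (d - 1))\<^sup>2 + 4 * \<beta>\<^sup>2" using reachable by (intro add_nonneg_pos) auto
  have L_pos: "0 < L" using denom reachable by (simp add: L_def)
  have tunnel: "TC E W x y = ereal L"
      "\<exists>f\<in>O[at_top](\<lambda>Q. Q ^ (d - 1)). TC_within E W f x y = ereal L"
      "\<forall>f\<in>o[at_top](\<lambda>Q. Q ^ (d - 1)). TC_within E W f x y \<le> 0"
    if "m_cospectral E (d - 1) x y"
    using tunneling_Liminf[OF F_nonneg F \<alpha>_zero[OF that]] unfolding TC_F TC_within_F L_def by auto
  have case1: "TC E W x y = 1" if co: "m_cospectral E d x y"
  proof -
    have "\<alpha> (d - 1) = 0" using \<alpha>_zero[OF co] d_pos by simp
    then have "L = 1" using reachable by (simp add: L_def)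
    then show ?thesis using tunnel(1) m_cospectral_mono[OF co, of "d - 1"] by simp
  qed
  have case2: "0 < TC E W x y \<and> TC E W x y < 1"
    if co: "m_cospectral E (d - 1) x y" "\<not> m_cospectral E d x y"
  proof -
    have "\<alpha> (d - 1) \<noteq> 0" using \<alpha>_nonzero[of "d - 1"] co d_pos by simp
    then have "4 * \<beta>\<^sup>2 < (\<alpha> (d - 1))\<^sup>2 + 4 * \<beta>\<^sup>2" by simp
    then have "L < 1" using denom by (simp add: L_def)
    then show ?thesis using tunnel(1)[OF co(1)] L_pos by simp
  qed
  have case3: "TC E W x y = 0" if co: "\<not> m_cospectral E (d - 1) x y"
  proof -
    \<comment> \<open>The last level of agreement: cospectral up to \<open>m\<close>, but not up to
      \<open>Suc m\<close>. Hence \<alpha> m is the first nonzero coefficient.\<close>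
    define m where "m = (LEAST k. \<not> m_cospectral E (Suc k) x y)"
    have co0: "m_cospectral E 0 x y" by (simp add: m_cospectral_def PR_def)
    have "d - 1 \<noteq> 0" using co co0 by metis
    then have ex: "\<not> m_cospectral E (Suc (d - 2)) x y" using co by (simp add: Suc_diff_Suc numeral_2_eq_2)
    have m1: "\<not> m_cospectral E (Suc m) x y" unfolding m_def by (rule LeastI[where P = "\<lambda>k. \<not> m_cospectral E (Suc k) x y", OF ex])
    have "m \<le> d - 2" unfolding m_def by (rule Least_le[where P = "\<lambda>k. \<not> m_cospectral E (Suc k) x y", OF ex])
    then have m: "m < d - 1" using \<open>d - 1 \<noteq> 0\<close> by simp
    have m2: "m_cospectral E m x y"
    proof (cases m)
      case (Suc k)
      then have "k < (LEAST k. \<not> m_cospectral E (Suc k) x y)" by (simp add: m_def)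
      from not_less_Least[OF this] show ?thesis using Suc by simp
    qed (use co0 in simp)
    show ?thesis unfolding TC_F
      using m by (intro no_tunneling_Liminf[OF F_nonneg F m \<alpha>_nonzero[OF m2 m1]] \<alpha>_zero[OF m2]) auto
  qed
  have time: "tunneling_time_Theta E W (\<lambda>Q. Q ^ (d - 1)) x y" if co: "m_cospectral E (d - 1) x y"
  proof -
    have "\<not> tunnels_within E W f x y" if "f \<in> o[at_top](\<lambda>Q. Q ^ (d - 1))" for f
    proof -
      \<comment> \<open>For f = o(Q^(d-1)) the time-limited coefficient is at most 0, so it cannot
        equal the positive value L.\<close>
      have "\<not> ereal L \<le> 0" using L_pos by (simp add: zero_ereal_def)
      then show ?thesis
        using tunnel(1)[OF co] bspec[OF tunnel(3)[OF co] that] by (metis tunnels_within_def)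
    qed
    then show ?thesis
      using tunnel(1,2)[OF co] unfolding tunneling_time_Theta_def tunnels_within_def by metis
  qed
  have time_sym: "tunneling_time_Theta E W (\<lambda>Q. Q ^ (d - 1)) y x \<longleftrightarrow> tunneling_time_Theta E W (\<lambda>Q. Q ^ (d - 1)) x y"
    by (simp add: tunneling_time_Theta_def tunnels_within_def TC_sym TC_within_sym)
  have eq_iff: "cospectrality E x y = enat (d - 1) \<longleftrightarrow> m_cospectral E (d - 1) x y \<and> \<not> m_cospectral E d x y"
  proof -
    \<comment> \<open>Since d > 0, d - 1 is a genuine predecessor, and equality means reaching d - 1
      but not d.\<close>
    have "cospectrality E x y = enat (d - 1) \<longleftrightarrow>
        enat (d - 1) \<le> cospectrality E x y \<and> \<not> enat d \<le> cospectrality E x y"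
      using d_pos by (cases "cospectrality E x y") auto
    then show ?thesis by (simp add: cospectrality_ge_iff)
  qed
  have lt_iff: "cospectrality E x y < enat (d - 1) \<longleftrightarrow> \<not> m_cospectral E (d - 1) x y"
    by (simp add: not_le[symmetric] cospectrality_ge_iff)
  show ?thesis
    unfolding TC_sym time_sym eq_iff cospectrality_ge_iff lt_iff
    using case1 case2 case3 time by blast
qed

end
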